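(* For each $\mathfrak{n}=1,2,3,\ldots$ let $m,n,K$ be positive integers with $K\le\min\{m,n\}$ and $\max\{m,n\}=\mathfrak{n}$, let $p_{ij}\in[0,1]$ for $1\le i<j\le \mathfrak{n}$, and let $\varrho_{ij}\in[0,1]$ for $1\le i<j\le K$ (all of these depend on $\mathfrak{n}$; the dependence is suppressed in the notation). Let $(G,H)$ be correlated Bernoulli random graphs with parameters $m,n,K,(p_{ij}),(\varrho_{ij})$. Assume: (1) for each $\mathfrak{n}$ there is a real number $q\in(0,\tfrac12)$ (depending on $\mathfrak{n}$) such that $p_{ij}\in[q,1-q]$ for all $1\le i<j\le\mathfrak{n}$ and $\varrho_{ij}>(1-2q)^2$ for all $1\le i<j\le K$; (2) with $\epsilon:=\min_{1\le i<j\le K}\left(\varrho_{ij}-(1-2q)^2\right)\in(0,1)$ (a function of $\mathfrak{n}$), it holds that $\lim_{\mathfrak{n}\to\infty}\frac{\epsilon^2K}{\log\mathfrak{n}}=\infty$. Let $A\in\{-1,0,1\}^{m\times m}$ and $B\in\{-1,0,1\}^{n\times n}$ be the $(1,-1,0)$-adjacency matrices of $G$ and $H$, respectively. Then it almost always holds (that is, with probability $1$, for all but finitely many values of $\mathfrak{n}$) that $$\arg\max_{X\in\Pi_{m,n,K}}\operatorname{trace}\left(AXBX^T\right)=\arg\max_{X\in\mathcal{D}_{m,n,K}}\operatorname{trace}\left(AXBX^T\right)=\left\{\begin{bmatrix}I_K&0\\0&0\end{bmatrix}\right\},$$ where $\begin{bmatrix}I_K&0\\0&0\end{bmatrix}$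 is the $m\times n$ matrix whose upper-left $K\times K$ block is the identity and whose other entries are all zero.
   Context: Graphs are simple (undirected, no loops, no multiple edges), and $[k]=\{1,\ldots,k\}$. Correlated Bernoulli random graphs: given positive integers $m,n,K$ with $K\le\min\{m,n\}$, numbers $p_{ij}\in[0,1]$ for $1\le i<j\le\max\{m,n\}$, and $\varrho_{ij}\in[0,1]$ for $1\le i<j\le K$, $(G,H)$ is a pair of random graphs where $G$ has vertex set $[m]$ and $H$ has vertex set $[n]$. For $1\le i<j\le m$, $\mathbb{P}(i\sim_G j)=p_{ij}$; for $1\le i<j\le n$, $\mathbb{P}(i\sim_H j)=p_{ij}$; for $1\le i<j\le K$ the Bernoulli indicators $\mathbf{1}_{i\sim_G j}$ and $\mathbf{1}_{i\sim_H j}$ have Pearson correlation coefficient $\varrho_{ij}$; and adjacencies are otherwise collectively independent (i.e. the pairs $(\mathbf{1}_{i\sim_G j},\mathbf{1}_{i\sim_H j})$ for $1\le i<j\le K$, together with all the remaining adjacency indicators of $G$ and of $H$, are mutually independent). The random graph pairs for the different values of $\mathfrak{n}$ are defined on a common probability space; nothing is assumed about the dependence between different values of $\mathfrak{n}$. $(1,-1,0)$-adjacency matrix of a graph: the symmetric matrix with entry $(i,j)$ equal to $1$ if vertices $i\ne j$ are adjacent, $-1$ if $i\ne j$ are not adjacent, and $0$ if $i=j$. $\Pi_{m,n,K}$ is the set of $X\in\{0,1\}^{m\times n}$ with at most one $1$ in each row, at most one $1$ in each column, and exactly $K$ entries equal to $1$. $\mathcal{D}_{m,n,K}$ is the set of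 nonnegative real $m\times n$ matrices with all row sums at most $1$, all column sums at most $1$, and the sum of all entries equal to $K$. $\arg\max$ denotes the set of all maximizers. *)

theory Defs
  imports
    "HOL-Probability.Probability"
    "Jordan_Normal_Form.Matrix"
    "Graph_Theory.Pair_Digraph"
begin

definition (in prob_space) covariance :: "('a \<Rightarrow> real) \<Rightarrow> ('a \<Rightarrow> real) \<Rightarrow> real" where
  "covariance X Y = expectation (\<lambda>\<omega>. (X \<omega> - expectation X) * (Y \<omega> - expectation Y))"

definition (in prob_space) pearson_correlation :: "('a \<Rightarrow> real) \<Rightarrow> ('a \<Rightarrow> real) \<Rightarrow> real" where
  "pearson_correlation X Y = covariance X Y / (sqrt (variance X) * sqrt (variance Y))"

text \<open>
  The collectively independent objects are the pairs of indicators of an edge in both graphs, for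
  edges within the first \<open>K\<close> vertices, and the single indicators of all other edges of \<open>G\<close>
  and of \<open>H\<close>. Every block takes values in \<open>bool \<times> bool\<close>; single indicators are padded
  with the constant \<open>False\<close>.
\<close>

datatype adj_block = Common nat nat | OnlyG nat nat | OnlyH nat nat

definition adj_blocks :: "nat \<Rightarrow> nat \<Rightarrow> nat \<Rightarrow> adj_block set" where
  "adj_blocks m n K =
     {Common i j | i j. 1 \<le> i \<and> i < j \<and> j \<le> K} \<union>
     {OnlyG i j | i j. 1 \<le> i \<and> i < j \<and> K < j \<and> j \<le> m} \<union>
     {OnlyH i j | i j. 1 \<le> i \<and> i < j \<and> K < j \<and> j \<le> n}"

fun block_adjacency ::
    "nat pair_pre_digraph \<Rightarrow> nat pair_pre_digraph \<Rightarrow> adj_block \<Rightarrow> bool \<times> bool" where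
  "block_adjacency G H (Common i j) = ((i, j) \<in> parcs G, (i, j) \<in> parcs H)"
| "block_adjacency G H (OnlyG i j) = ((i, j) \<in> parcs G, False)"
| "block_adjacency G H (OnlyH i j) = (False, (i, j) \<in> parcs H)"

text \<open>
  A \<^const>\<open>pair_graph\<close> is a finite loopless digraph with symmetric arc set and no parallel arcs,
  i.e. a finite simple graph. Measurability of the adjacency events is part of
  the independence assumption, as the blocks cover all possible edges.
\<close>

locale correlated_bernoulli_graphs = prob_space M
  for M :: "'a measure" +
  fixes m n K :: nat
    and p \<rho> :: "nat \<Rightarrow> nat \<Rightarrow> real"
    and G H :: "'a \<Rightarrow> nat pair_pre_digraph"
  assumes m_pos: "1 \<le> m" and n_pos: "1 \<le> n" and K_pos: "1 \<le> K"
    and K_le: "K \<le> min m n"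
    and p_range: "\<And>i j. 1 \<le> i \<Longrightarrow> i < j \<Longrightarrow> j \<le> max m n \<Longrightarrow> p i j \<in> {0..1}"
    and \<rho>_range: "\<And>i j. 1 \<le> i \<Longrightarrow> i < j \<Longrightarrow> j \<le> K \<Longrightarrow> \<rho> i j \<in> {0..1}"
    and G_graph: "\<And>\<omega>. \<omega> \<in> space M \<Longrightarrow> pair_graph (G \<omega>) \<and> pverts (G \<omega>) = {1..m}"
    and H_graph: "\<And>\<omega>. \<omega> \<in> space M \<Longrightarrow> pair_graph (H \<omega>) \<and> pverts (H \<omega>) = {1..n}"
    and G_prob: "\<And>i j. 1 \<le> i \<Longrightarrow> i < j \<Longrightarrow> j \<le> m \<Longrightarrow>
        prob {\<omega> \<in> space M. (i, j) \<in> parcs (G \<omega>)} = p i j"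
    and H_prob: "\<And>i j. 1 \<le> i \<Longrightarrow> i < j \<Longrightarrow> j \<le> n \<Longrightarrow>
        prob {\<omega> \<in> space M. (i, j) \<in> parcs (H \<omega>)} = p i j"
    and correlation: "\<And>i j. 1 \<le> i \<Longrightarrow> i < j \<Longrightarrow> j \<le> K \<Longrightarrow>
        pearson_correlation
          (\<lambda>\<omega>. of_bool ((i, j) \<in> parcs (G \<omega>))) (\<lambda>\<omega>. of_bool ((i, j) \<in> parcs (H \<omega>))) = \<rho> i j"
    and independence:
      "indep_vars (\<lambda>_. count_space UNIV) (\<lambda>b \<omega>. block_adjacency (G \<omega>) (H \<omega>) b)
         (adj_blocks m n K)"

text \<open>Vertices are numbered from 1, matrix indices from 0.\<close>

definition signed_adj_mat :: "nat \<Rightarrow> nat pair_pre_digraph \<Rightarrow> real mat" where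
  "signed_adj_mat k G =
     mat k k (\<lambda>(i, j). if i = j then 0 else if (Suc i, Suc j) \<in> parcs G then 1 else -1)"

definition mat_trace :: "'a::comm_monoid_add mat \<Rightarrow> 'a" where
  "mat_trace A = (\<Sum>i<dim_row A. A $$ (i, i))"

definition partial_perm_mats :: "nat \<Rightarrow> nat \<Rightarrow> nat \<Rightarrow> real mat set" where
  "partial_perm_mats m n K =
     {X \<in> carrier_mat m n.
        (\<forall>i<m. \<forall>j<n. X $$ (i, j) \<in> {0, 1}) \<and>
        (\<forall>i<m. card {j. j < n \<and> X $$ (i, j) = 1} \<le> 1) \<and>
        (\<forall>j<n. card {i. i < m \<and> X $$ (i, j) = 1} \<le> 1) \<and>
        card {(i, j). i < m \<and> j < n \<and> X $$ (i, j) = 1} = K}"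

definition doubly_substochastic_mats :: "nat \<Rightarrow> nat \<Rightarrow> nat \<Rightarrow> real mat set" where
  "doubly_substochastic_mats m n K =
     {X \<in> carrier_mat m n.
        (\<forall>i<m. \<forall>j<n. 0 \<le> X $$ (i, j)) \<and>
        (\<forall>i<m. (\<Sum>j<n. X $$ (i, j)) \<le> 1) \<and>
        (\<forall>j<n. (\<Sum>i<m. X $$ (i, j)) \<le> 1) \<and>
        (\<Sum>i<m. \<Sum>j<n. X $$ (i, j)) = real K}"

definition argmax_set :: "('a \<Rightarrow> 'b::linorder) \<Rightarrow> 'a set \<Rightarrow> 'a set" where
  "argmax_set f S = {x. is_arg_max f (\<lambda>x. x \<in> S) x}"

definition core_identity_mat :: "nat \<Rightarrow> nat \<Rightarrow> nat \<Rightarrow> real mat" where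
  "core_identity_mat m n K =
     four_block_mat (1\<^sub>m K) (0\<^sub>m K (n - K)) (0\<^sub>m (m - K) K) (0\<^sub>m (m - K) (n - K))"

end

theory Submission
  imports Defs
begin

text \<open>
  The objective is a diagonal value of the bilinear form $(X, Z) \mapsto$ trace$(A X B Z^T)$, and a
  linear functional on the relaxed polytope is maximal at a partial permutation matrix. Applied to
  each argument in turn, this reduces the claim to a strict comparison of \<open>(P, Q)\<close> with
  \<open>(I, I)\<close> for all pairs of partial permutations, including pairs with different components.

  Identify partial permutations with sets of index pairs, let \<open>k\<close> be the total number of pairs of
  \<open>P\<close> and \<open>Q\<close> off the diagonal, and let \<open>L\<close>, between \<open>K k / 2\<close> and \<open>K k\<close>, be the number of terms in
  which the value at \<open>(P, Q)\<close> differs from that at \<open>(I, I)\<close>. A matched term has mean at least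
  $\varrho \ge (1-2q)^2 + \epsilon$ and a mismatched one has mean at most $(1-2q)^2$, apart from
  \<open>O(k)\<close> exceptional terms (swaps and loops), so the mean difference is at most \<open>- L \<epsilon> / 2\<close>. Every
  independent block influences boundedly many terms, so McDiarmid's inequality bounds the failure
  probability by \<open>exp (- K k \<epsilon>\<^sup>2 / 512)\<close>, which is at most \<open>N\<close> to the power \<open>- 12 k\<close> eventually. There
  are at most \<open>N\<close> to the power \<open>O(k)\<close> pairs with given \<open>k\<close>, and Borel--Cantelli applies.
\<close>

subsection \<open>McDiarmid's inequality\<close>

text \<open>The form X -> trace (A X B X^T) is in general not convex, so its values at 0/1 matrices
  alone do not bound it at fractional X. Freeing the two arguments makes each step a linear program,
  at the price that mixed pairs (P, Q) must be beaten too. The two linear bounds are only weak.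
  Strictness is recovered by adding a small reward for mass off the diagonal: finitely many pairs
  compete, so their gaps leave room for it. The threshold (1-2q)^2 bounds a product of two
  independent entry means, each of absolute value at most 1-2q. A correlated pair has mean \<rho> +
  (1-\<rho>)(2p-1)^2, which is at least \<rho>. Concentration must be applied after the terms common
  to both values have cancelled. With all K^2 terms present the exponent would be of order k^2
  \<epsilon>^2, too weak for small k; with order L terms it is of order K k \<epsilon>^2, which the
  growth hypothesis compares with k log N. The union bound is carried out as a generating function
  in k rather than level by level.\<close>

lemma finite_set_Pi_pmf_finite:
  fixes q :: "'i \<Rightarrow> 'c::finite pmf"
  assumes "finite I"
  shows "finite (set_pmf (Pi_pmf I d q))"
proof (rule finite_subset[OF set_Pi_pmf_subset'[OF assms]])
  show "finite (PiE_dflt I d (set_pmf \<circ> q))"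
    using assms by (intro finite_PiE_dflt) auto
qed

text \<open>Fubini for one coordinate. The finite value type makes every expectation here a finite
  sum, so \<open>h\<close> can be arbitrary.\<close>

lemma expectation_Pi_pmf_insert:
  fixes q :: "'i \<Rightarrow> 'c::finite pmf" and h :: "('i \<Rightarrow> 'c) \<Rightarrow> real"
  assumes "finite I" "b \<notin> I"
  shows "measure_pmf.expectation (Pi_pmf (insert b I) d q) h =
         measure_pmf.expectation (q b)
           (\<lambda>y. measure_pmf.expectation (Pi_pmf I d q) (\<lambda>x. h (x(b := y))))"
proof -
  have "Pi_pmf (insert b I) d q =
      q b \<bind> (\<lambda>y. map_pmf (\<lambda>x. x(b := y)) (Pi_pmf I d q))"
    using assms by (simp add: Pi_pmf_insert' map_pmf_def)
  then show ?thesis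
    using assms finite_set_Pi_pmf_finite[of I d q]
    by (simp add: pmf_expectation_bind[where A = UNIV] integral_measure_pmf[of UNIV])
qed

text \<open>McDiarmid's martingale argument as an induction on coordinates. Averaging
  \<open>f\<close> over the other coordinates leaves a function \<open>g\<close> of coordinate
  \<open>b\<close> whose range has length at most \<open>c b\<close>, so Hoeffding's lemma handles
  \<open>g\<close>; the induction hypothesis handles \<open>f\<close> minus \<open>g\<close> for
  each fixed value at \<open>b\<close>. The one-sided difference bound is two-sided, since
  \<open>x\<close> and \<open>x(b := y)\<close> may be exchanged.\<close>

lemma Pi_pmf_bounded_differences_mgf:
  fixes f :: "('i \<Rightarrow> 'c::finite) \<Rightarrow> real" and q :: "'i \<Rightarrow> 'c pmf"
  assumes "finite I" and l: "l > 0"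
    and "\<And>b x y. b \<in> I \<Longrightarrow> f (x(b := y)) - f x \<le> c b"
  shows "measure_pmf.expectation (Pi_pmf I d q)
           (\<lambda>x. exp (l * (f x - measure_pmf.expectation (Pi_pmf I d q) f)))
         \<le> exp (l\<^sup>2 * (\<Sum>b\<in>I. (c b)\<^sup>2) / 8)"
  using assms(1,3)
proof (induction I arbitrary: f rule: finite_induct)
  case empty
  then show ?case by simp
next
  case (insert b I)
  define P where "P = Pi_pmf I d q"
  define g where "g y = measure_pmf.expectation P (\<lambda>x. f (x(b := y)))" for y
  define \<mu> where "\<mu> = measure_pmf.expectation (Pi_pmf (insert b I) d q) f"
  define W where "W = exp (l\<^sup>2 * (\<Sum>b\<in>I. (c b)\<^sup>2) / 8)"
  have finP: "finite (set_pmf P)"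
    unfolding P_def by (rule finite_set_Pi_pmf_finite) fact
  have intP: "integrable P h" for h :: "_ \<Rightarrow> real"
    using finP by (rule integrable_measure_pmf_finite)
  have intq: "integrable (q b) h" for h :: "_ \<Rightarrow> real"
    by (rule integrable_measure_pmf_finite) auto
  have mu: "\<mu> = measure_pmf.expectation (q b) g"
    unfolding \<mu>_def g_def P_def using insert.hyps by (rule expectation_Pi_pmf_insert)
  have IH: "measure_pmf.expectation P (\<lambda>x. exp (l * (f (x(b := y)) - g y))) \<le> W" for y
    unfolding P_def g_def W_def
  proof (rule insert.IH)
    fix b' x y' assume "b' \<in> I"
    then have "b' \<noteq> b" using insert.hyps by auto
    then show "f ((x(b' := y'))(b := y)) - f (x(b := y)) \<le> c b'"
      using insert.prems[of b' "x(b := y)" y'] \<open>b' \<in> I\<close>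
      by (simp only: fun_upd_twist[of b' b] insert_iff simp_thms)
  qed
  have step: "g y' - g y \<le> c b" for y y'
  proof -
    have "g y' - g y = measure_pmf.expectation P (\<lambda>x. f (x(b := y')) - f (x(b := y)))"
      unfolding g_def by (simp add: intP)
    also have "\<dots> \<le> measure_pmf.expectation P (\<lambda>x. c b)"
      using insert.prems[of b "x(b := y)" y' for x]
      by (intro integral_mono intP) (simp only: fun_upd_upd insertI1)
    finally show ?thesis by simp
  qed
  \<comment> \<open>Hoeffding's lemma needs an explicit interval of length \<open>c b\<close>.
    Anchored at the minimum of \<open>g\<close>, which is attained since the value type is finite,
    its upper end is supplied by \<open>step\<close>.\<close>
  define lo where "lo = Min (range g)"
  have "lo \<in> range g"
    unfolding lo_def by (rule Min_in) auto
  then obtain y0 where y0: "lo = g y0" by (elim rangeE)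
  interpret H: interval_bounded_random_variable "measure_pmf (q b)" g lo "lo + c b"
  proof unfold_locales
    have "lo \<le> g y" "g y \<le> lo + c b" for y
      using step[of y y0] unfolding y0[symmetric] by (auto simp: lo_def)
    then show "AE y in measure_pmf (q b). g y \<in> {lo..lo + c b}" by auto
  qed auto
  have "ennreal (measure_pmf.expectation (q b) (\<lambda>y. exp (l * (g y - \<mu>)))) =
      (\<integral>\<^sup>+ y. ennreal (exp (l * (g y - \<mu>))) \<partial>q b)"
    by (rule nn_integral_eq_integral[symmetric, OF intq]) auto
  also have "\<dots> \<le> ennreal (exp (l\<^sup>2 * (c b)\<^sup>2 / 8))"
    using H.Hoeffdings_lemma_nn_integral[OF l] by (simp add: mu)
  finally have hoeff: "measure_pmf.expectation (q b) (\<lambda>y. exp (l * (g y - \<mu>)))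
      \<le> exp (l\<^sup>2 * (c b)\<^sup>2 / 8)" by simp
  have "measure_pmf.expectation (Pi_pmf (insert b I) d q) (\<lambda>x. exp (l * (f x - \<mu>))) =
      measure_pmf.expectation (q b)
        (\<lambda>y. measure_pmf.expectation P (\<lambda>x. exp (l * (f (x(b := y)) - \<mu>))))"
    unfolding P_def using insert.hyps by (rule expectation_Pi_pmf_insert)
  also have "\<dots> = measure_pmf.expectation (q b) (\<lambda>y. exp (l * (g y - \<mu>)) *
        measure_pmf.expectation P (\<lambda>x. exp (l * (f (x(b := y)) - g y))))"
    by (simp add: integral_mult_right_zero[symmetric] exp_add[symmetric] algebra_simps
        del: integral_mult_right_zero)
  also have "\<dots> \<le> measure_pmf.expectation (q b) (\<lambda>y. exp (l * (g y - \<mu>)) * W)"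
    by (intro integral_mono intq mult_left_mono IH) auto
  also have "\<dots> \<le> exp (l\<^sup>2 * (c b)\<^sup>2 / 8) * W"
    using hoeff by (simp add: W_def)
  also have "\<dots> = exp (l\<^sup>2 * (\<Sum>b\<in>insert b I. (c b)\<^sup>2) / 8)"
    using insert.hyps by (simp add: W_def exp_add[symmetric] field_simps)
  finally show ?case by (simp add: \<mu>_def)
qed

section \<open>Transfer to independent random variables on a general probability space\<close>

text \<open>Independence makes the joint law the product of the marginals \<open>q i\<close>, so
  expectations can be computed in a discrete product. Coordinates outside \<open>I\<close> are set
  to \<open>d\<close> to match the default value of \<open>Pi_pmf\<close>.\<close>

lemma (in prob_space) indep_vars_expectation_Pi_pmf:
  fixes X :: "'i \<Rightarrow> 'a \<Rightarrow> 'c::finite"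
  assumes fin: "finite I" and ind: "indep_vars (\<lambda>_. count_space UNIV) X I"
  obtains q where "\<And>h :: ('i \<Rightarrow> 'c) \<Rightarrow> real.
      expectation (\<lambda>\<omega>. h (\<lambda>i. if i \<in> I then X i \<omega> else d)) =
      measure_pmf.expectation (Pi_pmf I d q) h"
proof -
  define q where "q i = embed_pmf (\<lambda>v. prob (X i -` {v} \<inter> space M))" for i
  have X [measurable]: "X i \<in> measurable M (count_space UNIV)" if "i \<in> I" for i
    using ind that by (auto simp: indep_vars_def)
  have q: "pmf (q i) v = prob (X i -` {v} \<inter> space M)" if i: "i \<in> I" for i v
    unfolding q_def
  proof (rule pmf_embed_pmf)
    have "(\<Sum>v\<in>UNIV. prob (X i -` {v} \<inter> space M)) =
        prob (\<Union>v\<in>UNIV. X i -` {v} \<inter> space M)"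
      using measurable_sets[OF X[OF i]]
      by (intro finite_measure_finite_Union[symmetric]) (auto simp: disjoint_family_on_def)
    also have "(\<Union>v\<in>UNIV. X i -` {v} \<inter> space M) = space M" by auto
    finally have "(\<Sum>v\<in>UNIV. prob (X i -` {v} \<inter> space M)) = 1" by (simp add: prob_space)
    then show "(\<integral>\<^sup>+ v. ennreal (prob (X i -` {v} \<inter> space M)) \<partial>count_space UNIV) = 1"
      by (simp add: nn_integral_count_space_finite)
  qed auto
  have "expectation (\<lambda>\<omega>. h (\<lambda>i. if i \<in> I then X i \<omega> else d)) =
      measure_pmf.expectation (Pi_pmf I d q) h" for h :: "('i \<Rightarrow> 'c) \<Rightarrow> real"
  proof -
    define V where "V = PiE_dflt I d (\<lambda>_. UNIV :: 'c set)"
    define E where "E v = {\<omega> \<in> space M. \<forall>i\<in>I. X i \<omega> = v i}" for v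
    have V: "finite V" unfolding V_def using fin by (intro finite_PiE_dflt) auto
    have Em [measurable]: "E v \<in> sets M" for v
      unfolding E_def using fin
      by (intro sets.sets_Collect_finite_All) (auto intro!: measurable_sets_Collect[OF X])
    have E: "prob (E v) = pmf (Pi_pmf I d q) v" if v: "v \<in> V" for v
    proof (cases "I = {}")
      case True
      then show ?thesis using v by (auto simp: E_def V_def PiE_dflt_def prob_space fun_eq_iff)
    next
      case False
      have "E v = (\<Inter>i\<in>I. X i -` {v i} \<inter> space M)" using False by (auto simp: E_def)
      also have "prob \<dots> = (\<Prod>i\<in>I. prob (X i -` {v i} \<inter> space M))"
        using indep_varsD_finite[OF ind False fin, of "\<lambda>i. {v i}"] by simp
      also have "\<dots> = pmf (Pi_pmf I d q) v"
        using v fin by (subst pmf_Pi') (auto simp: q V_def PiE_dflt_def)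
      finally show ?thesis .
    qed
    have "expectation (\<lambda>\<omega>. h (\<lambda>i. if i \<in> I then X i \<omega> else d)) =
        expectation (\<lambda>\<omega>. \<Sum>v\<in>V. h v * indicator (E v) \<omega>)"
    proof (rule Bochner_Integration.integral_cong[OF refl])
      fix \<omega> assume w: "\<omega> \<in> space M"
      let ?x = "\<lambda>i. if i \<in> I then X i \<omega> else d"
      have "(\<Sum>v\<in>V. h v * indicator (E v) \<omega>) = (\<Sum>v\<in>V. if v = ?x then h v else 0)"
        using w by (intro sum.cong) (auto simp: E_def V_def PiE_dflt_def fun_eq_iff indicator_def)
      also have "\<dots> = h ?x" using V by (simp add: V_def PiE_dflt_def)
      finally show "h ?x = (\<Sum>v\<in>V. h v * indicator (E v) \<omega>)" by simp
    qed
    also have "\<dots> = (\<Sum>v\<in>V. h v * prob (E v))"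
      by (subst Bochner_Integration.integral_sum) (auto simp: Em emeasure_eq_measure)
    also have "\<dots> = (\<Sum>v\<in>V. h v * pmf (Pi_pmf I d q) v)" using E by simp
    also have "\<dots> = measure_pmf.expectation (Pi_pmf I d q) h"
    proof (subst integral_measure_pmf[OF V])
      fix x assume "x \<in> set_pmf (Pi_pmf I d q)"
      then show "x \<in> V" using set_Pi_pmf_subset[OF fin, of d q] by (auto simp: V_def PiE_dflt_def)
    qed (simp add: mult.commute)
    finally show ?thesis .
  qed
  then show ?thesis using that by blast
qed

text \<open>McDiarmid's inequality. Measurability of \<open>X b\<close> is known only for
  \<open>b\<close> in \<open>I\<close>; \<open>dep\<close> allows the other coordinates to be
  replaced by a constant, which moves the event and the expectation into the product space.\<close>

lemma (in prob_space) bounded_differences_tail: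
  fixes X :: "'i \<Rightarrow> 'a \<Rightarrow> 'c::finite" and f :: "('i \<Rightarrow> 'c) \<Rightarrow> real"
  assumes fin: "finite I" and ind: "indep_vars (\<lambda>_. count_space UNIV) X I"
    and bd: "\<And>b x y. b \<in> I \<Longrightarrow> f (x(b := y)) - f x \<le> c b"
    and dep: "\<And>x y. (\<And>b. b \<in> I \<Longrightarrow> x b = y b) \<Longrightarrow> f x = f y"
    and V: "(\<Sum>b\<in>I. (c b)\<^sup>2) \<le> V" "V > 0" and s: "s > 0"
  shows "{\<omega> \<in> space M. expectation (\<lambda>\<omega>. f (\<lambda>b. X b \<omega>)) + s \<le> f (\<lambda>b. X b \<omega>)} \<in> sets M"
    and "prob {\<omega> \<in> space M. expectation (\<lambda>\<omega>. f (\<lambda>b. X b \<omega>)) + s \<le> f (\<lambda>b. X b \<omega>)}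
         \<le> exp (- 2 * s\<^sup>2 / V)"
proof -
  define d :: 'c where "d = undefined"
  define x where "x \<omega> = (\<lambda>i. if i \<in> I then X i \<omega> else d)" for \<omega>
  obtain q where q: "\<And>h :: ('i \<Rightarrow> 'c) \<Rightarrow> real.
      expectation (\<lambda>\<omega>. h (x \<omega>)) = measure_pmf.expectation (Pi_pmf I d q) h"
    unfolding x_def using indep_vars_expectation_Pi_pmf[OF fin ind, of d] by blast
  have X [measurable]: "X i \<in> measurable M (count_space UNIV)" if "i \<in> I" for i
    using ind that by (auto simp: indep_vars_def)
  define U where "U = PiE_dflt I d (\<lambda>_. UNIV :: 'c set)"
  have U: "finite U" "x \<omega> \<in> U" for \<omega>
    unfolding U_def using fin
    by (rule finite_PiE_dflt, simp) (simp add: PiE_dflt_def x_def)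
  have meas: "{\<omega> \<in> space M. P (x \<omega>)} \<in> sets M" for P
  proof -
    have "{\<omega> \<in> space M. P (x \<omega>)} =
        (\<Union>v\<in>{v\<in>U. P v}. {\<omega> \<in> space M. \<forall>i\<in>I. X i \<omega> = v i})" (is "?L = ?R")
    proof
      show "?L \<subseteq> ?R"
      proof
        fix \<omega> assume "\<omega> \<in> ?L"
        then show "\<omega> \<in> ?R" by (intro UN_I[of "x \<omega>"]) (auto simp: U, auto simp: x_def)
      qed
      have "x \<omega> = v" if "v \<in> U" "\<forall>i\<in>I. X i \<omega> = v i" for \<omega> v
        using that by (auto simp: x_def U_def PiE_dflt_def fun_eq_iff)
      then show "?R \<subseteq> ?L" by auto
    qed
    moreover have "{\<omega> \<in> space M. \<forall>i\<in>I. X i \<omega> = v i} \<in> sets M" for v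
      using fin by (intro sets.sets_Collect_finite_All) (auto intro!: measurable_sets_Collect[OF X])
    ultimately show ?thesis using U by auto
  qed
  have int: "integrable M (\<lambda>\<omega>. h (x \<omega>))" for h :: "_ \<Rightarrow> real"
  proof (rule integrable_const_bound)
    show "AE \<omega> in M. norm (h (x \<omega>)) \<le> (\<Sum>v\<in>U. \<bar>h v\<bar>)"
      using U by (auto intro!: member_le_sum[of _ U "\<lambda>v. \<bar>h v\<bar>"])
    show "(\<lambda>\<omega>. h (x \<omega>)) \<in> borel_measurable M"
    proof (rule borel_measurableI)
      fix S :: "real set"
      have "(\<lambda>\<omega>. h (x \<omega>)) -` S \<inter> space M = {\<omega> \<in> space M. h (x \<omega>) \<in> S}" by auto
      then show "(\<lambda>\<omega>. h (x \<omega>)) -` S \<inter> space M \<in> sets M" using meas[of "\<lambda>v. h v \<in> S"] by simp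
    qed
  qed
  have fx: "f (\<lambda>b. X b \<omega>) = f (x \<omega>)" for \<omega>
    by (rule dep) (simp add: x_def)
  show "{\<omega> \<in> space M. expectation (\<lambda>\<omega>. f (\<lambda>b. X b \<omega>)) + s \<le> f (\<lambda>b. X b \<omega>)} \<in> sets M"
    unfolding fx by (rule meas)
  define \<mu> where "\<mu> = expectation (\<lambda>\<omega>. f (x \<omega>))"
  \<comment> \<open>The minimiser of l^2 V / 8 - l s, the exponent of the Chernoff bound; the
    minimum is -2 s^2 / V.\<close>
  define l where "l = 4 * s / V"
  have l: "l > 0" using s V by (simp add: l_def)
  have "expectation (\<lambda>\<omega>. exp (l * (f (x \<omega>) - \<mu>))) =
      measure_pmf.expectation (Pi_pmf I d q) (\<lambda>v. exp (l * (f v - \<mu>)))"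
    by (rule q)
  also have "\<dots> \<le> exp (l\<^sup>2 * (\<Sum>b\<in>I. (c b)\<^sup>2) / 8)"
    unfolding \<mu>_def q by (rule Pi_pmf_bounded_differences_mgf[OF fin l bd])
  also have "\<dots> \<le> exp (l\<^sup>2 * V / 8)"
    using V by (auto intro!: mult_left_mono)
  finally have mgf: "expectation (\<lambda>\<omega>. exp (l * (f (x \<omega>) - \<mu>))) \<le> exp (l\<^sup>2 * V / 8)" .
  have "\<mu> + s \<le> y \<longleftrightarrow> exp (l * s) \<le> exp (l * (y - \<mu>))" for y
    using mult_le_cancel_left_pos[OF l, of s "y - \<mu>"] by (simp add: le_diff_eq add.commute)
  then have "{\<omega> \<in> space M. \<mu> + s \<le> f (x \<omega>)} =
      {\<omega> \<in> space M. exp (l * s) \<le> exp (l * (f (x \<omega>) - \<mu>))}"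
    by simp
  also have "prob \<dots> \<le> expectation (\<lambda>\<omega>. exp (l * (f (x \<omega>) - \<mu>))) / exp (l * s)"
    by (rule integral_Markov_inequality_measure[where A = "space M", simplified])
       (auto intro!: int[of "\<lambda>v. exp (l * (f v - \<mu>))"])
  also have "\<dots> \<le> exp (l\<^sup>2 * V / 8) / exp (l * s)"
    using mgf by (intro divide_right_mono) auto
  also have "\<dots> = exp (- 2 * s\<^sup>2 / V)"
    using V by (simp add: exp_diff[symmetric] l_def field_simps power2_eq_square)
  finally show "prob {\<omega> \<in> space M. expectation (\<lambda>\<omega>. f (\<lambda>b. X b \<omega>)) + s \<le> f (\<lambda>b. X b \<omega>)}
         \<le> exp (- 2 * s\<^sup>2 / V)"
    unfolding fx \<mu>_def .
qed

subsection \<open>Integrality of transportation polytopes\<close>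

lemma underdetermined_system:
  fixes a :: "'c \<Rightarrow> 'e \<Rightarrow> real"
  assumes "finite C" "finite E" "card C < card E"
  shows "\<exists>z. (\<exists>e\<in>E. z e \<noteq> 0) \<and> (\<forall>e. e \<notin> E \<longrightarrow> z e = 0) \<and> (\<forall>c\<in>C. (\<Sum>e\<in>E. a c e * z e) = 0)"
  using assms
proof (induction C arbitrary: E a rule: finite_induct)
  case empty
  then obtain e where "e \<in> E" by fastforce
  then show ?case by (intro exI[of _ "\<lambda>x. of_bool (x = e)"]) auto
next
  case (insert c C)
  show ?case
  proof (cases "\<forall>e\<in>E. a c e = 0")
    case True
    have "card C < card E" using insert by simp
    from insert.IH[OF insert.prems(1) this, of a] True show ?thesis by auto
  next
    case False
    then obtain e0 where e0: "e0 \<in> E" "a c e0 \<noteq> 0" by auto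
    define E' where "E' = E - {e0}"
    have fin: "finite E'" "card C < card E'"
      using insert e0 by (auto simp: E'_def)
    obtain z where z: "\<exists>e\<in>E'. z e \<noteq> 0" "\<forall>e. e \<notin> E' \<longrightarrow> z e = 0"
      "\<And>c'. c' \<in> C \<Longrightarrow> (\<Sum>e\<in>E'. (a c' e - a c' e0 * a c e / a c e0) * z e) = 0"
      using insert.IH[OF fin, of "\<lambda>c' e. a c' e - a c' e0 * a c e / a c e0"] by blast
    define s where "s = (\<Sum>e\<in>E'. a c e * z e)"
    define w where "w = z(e0 := - s / a c e0)"
    have split: "(\<Sum>e\<in>E. a c' e * w e) = (\<Sum>e\<in>E'. a c' e * z e) - a c' e0 * s / a c e0" for c'
    proof -
      have "(\<Sum>e\<in>E. a c' e * w e) = a c' e0 * w e0 + (\<Sum>e\<in>E'. a c' e * w e)"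
        unfolding E'_def using insert.prems(1) e0(1) by (rule sum.remove)
      moreover have "(\<Sum>e\<in>E'. a c' e * w e) = (\<Sum>e\<in>E'. a c' e * z e)"
        by (intro sum.cong) (auto simp: w_def E'_def)
      ultimately show ?thesis by (simp add: w_def)
    qed
    have "(\<Sum>e\<in>E. a c' e * w e) = 0" if "c' \<in> insert c C" for c'
    proof (cases "c' = c")
      case True
      then show ?thesis using e0 by (simp add: split s_def)
    next
      case False
      then have "c' \<in> C" using that by simp
      from z(3)[OF this] show ?thesis
        unfolding split s_def
        by (simp add: left_diff_distrib sum_subtractf sum_distrib_left sum_divide_distrib mult.assoc)
    qed
    moreover have "\<exists>e\<in>E. w e \<noteq> 0" "\<forall>e. e \<notin> E \<longrightarrow> w e = 0"
      using z(1,2) e0(1) by (auto simp: w_def E'_def)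
    ultimately show ?thesis by blast
  qed
qed

lemma Ints_sum_two_nonints:
  fixes x :: "'a \<Rightarrow> real"
  assumes "finite A" "sum x A \<in> \<int>" "a \<in> A" "x a \<notin> \<int>"
  shows "\<exists>b\<in>A. b \<noteq> a \<and> x b \<notin> \<int>"
proof (rule ccontr)
  assume "\<not> ?thesis"
  then have "sum x (A - {a}) \<in> \<int>" by (intro Ints_sum) auto
  moreover have "x a = sum x A - sum x (A - {a})"
    using assms by (simp add: sum.remove)
  ultimately show False using assms by (metis Ints_diff)
qed

lemma card_ge_twice_image:
  assumes "finite F" "\<And>e. e \<in> F \<Longrightarrow> \<exists>e'\<in>F. e' \<noteq> e \<and> g e' = g e"
  shows "2 * card (g ` F) \<le> card F"
proof -
  have "2 \<le> card {e \<in> F. g e = r}" if "r \<in> g ` F" for r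
  proof -
    obtain e where e: "e \<in> F" "g e = r" using \<open>r \<in> g ` F\<close> by blast
    obtain e' where "e' \<in> F" "e' \<noteq> e" "g e' = r" using assms(2)[OF e(1)] e by blast
    have "card {e, e'} \<le> card {e \<in> F. g e = r}"
      using assms(1) e \<open>e' \<in> F\<close> \<open>g e' = r\<close> by (intro card_mono) auto
    then show ?thesis using \<open>e' \<noteq> e\<close> by simp
  qed
  then have "(\<Sum>r\<in>g ` F. 2) \<le> (\<Sum>r\<in>g ` F. card {e \<in> F. g e = r})"
    by (intro sum_mono) auto
  also have "\<dots> = card F"
    using sum.image_gen[OF assms(1), of "\<lambda>_. 1::nat" g] by simp
  finally show ?thesis by simp
qed

text \<open>Replaces the usual search for a cycle by a dimension count. A line with integral sum
  cannot contain exactly one fractional entry, so each row and column that meets the set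
  \<open>F\<close> of fractional entries meets it twice; hence rows and columns met number at most
  \<open>card F\<close>. One column equation follows from the others, so there are fewer equations
  than unknowns.\<close>

lemma fractional_circulation:
  fixes x :: "'r \<Rightarrow> 'c \<Rightarrow> real"
  assumes fin: "finite R" "finite C"
    and rows: "\<And>i. i \<in> R \<Longrightarrow> (\<Sum>j\<in>C. x i j) \<in> \<int>"
    and cols: "\<And>j. j \<in> C \<Longrightarrow> (\<Sum>i\<in>R. x i j) \<in> \<int>"
    and frac: "i0 \<in> R" "j0 \<in> C" "x i0 j0 \<notin> \<int>"
  obtains z where "\<exists>i\<in>R. \<exists>j\<in>C. z i j \<noteq> 0" "\<And>i j. x i j \<in> \<int> \<Longrightarrow> z i j = 0"
    "\<And>i. i \<in> R \<Longrightarrow> (\<Sum>j\<in>C. z i j) = (0::real)" "\<And>j. j \<in> C \<Longrightarrow> (\<Sum>i\<in>R. z i j) = 0"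
proof -
  define F where "F = {(i, j) \<in> R \<times> C. x i j \<notin> \<int>}"
  have F: "finite F"
    by (rule finite_subset[OF _ finite_cartesian_product[OF fin]]) (auto simp: F_def)
  have "(i0, j0) \<in> F" using frac by (simp add: F_def)
  then have j0: "j0 \<in> snd ` F" by (rule image_eqI[rotated]) simp
  have two_R: "2 * card (fst ` F) \<le> card F"
  proof (rule card_ge_twice_image[OF F])
    fix e assume "e \<in> F"
    then obtain i j where e: "e = (i, j)" "i \<in> R" "j \<in> C" "x i j \<notin> \<int>" by (auto simp: F_def)
    from Ints_sum_two_nonints[OF fin(2) rows[OF e(2)] e(3,4)]
    obtain j' where "j' \<in> C" "j' \<noteq> j" "x i j' \<notin> \<int>" by blast
    then show "\<exists>e'\<in>F. e' \<noteq> e \<and> fst e' = fst e"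
      using e by (intro bexI[of _ "(i, j')"]) (simp_all add: F_def)
  qed
  have two_C: "2 * card (snd ` F) \<le> card F"
  proof (rule card_ge_twice_image[OF F])
    fix e assume "e \<in> F"
    then obtain i j where e: "e = (i, j)" "i \<in> R" "j \<in> C" "x i j \<notin> \<int>" by (auto simp: F_def)
    from Ints_sum_two_nonints[OF fin(1) cols[OF e(3)] e(2,4)]
    obtain i' where "i' \<in> R" "i' \<noteq> i" "x i' j \<notin> \<int>" by blast
    then show "\<exists>e'\<in>F. e' \<noteq> e \<and> snd e' = snd e"
      using e by (intro bexI[of _ "(i', j)"]) (simp_all add: F_def)
  qed
  \<comment> \<open>The column \<open>j0\<close> is omitted: its sum vanishes because all row sums
    and all other column sums do.\<close>
  define cons where "cons = Inl ` (fst ` F) \<union> Inr ` (snd ` F - {j0})"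
  define a :: "'r + 'c \<Rightarrow> 'r \<times> 'c \<Rightarrow> real" where
    "a c e = (case c of Inl i \<Rightarrow> of_bool (fst e = i) | Inr j \<Rightarrow> of_bool (snd e = j))" for c e
  have "card cons = card (fst ` F) + card (snd ` F - {j0})"
    unfolding cons_def using F
    by (subst card_Un_disjoint) (auto simp: card_image)
  moreover have "card (snd ` F - {j0}) < card (snd ` F)"
    using j0 F by (intro psubset_card_mono) auto
  ultimately have less: "card cons < card F" using two_R two_C by linarith
  have "finite cons" using F by (auto simp: cons_def)
  from underdetermined_system[OF this F less, of a] obtain w where
    w: "\<exists>e\<in>F. w e \<noteq> 0" "\<And>e. e \<notin> F \<Longrightarrow> w e = 0"
       "\<And>c. c \<in> cons \<Longrightarrow> (\<Sum>e\<in>F. a c e * w e) = 0" by blast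
  have ext: "(\<Sum>i\<in>R. \<Sum>j\<in>C. a c (i, j) * w (i, j)) = 0" if c: "c \<in> cons" for c
  proof -
    have "(\<Sum>i\<in>R. \<Sum>j\<in>C. a c (i, j) * w (i, j)) = (\<Sum>e\<in>R \<times> C. a c e * w e)"
      by (rule sum.cartesian_product'[symmetric])
    also have "\<dots> = (\<Sum>e\<in>F. a c e * w e)"
      using w(2) fin by (intro sum.mono_neutral_right) (auto simp: F_def)
    finally show ?thesis using w(3)[OF c] by simp
  qed
  have row: "(\<Sum>j\<in>C. w (i, j)) = 0" if i: "i \<in> R" for i
  proof (cases "i \<in> fst ` F")
    case True
    then have "0 = (\<Sum>i'\<in>R. \<Sum>j\<in>C. a (Inl i) (i', j) * w (i', j))"
      by (intro ext[symmetric]) (auto simp: cons_def)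
    also have "\<dots> = (\<Sum>i'\<in>R. if i' = i then \<Sum>j\<in>C. w (i', j) else 0)"
      by (intro sum.cong) (auto simp: a_def)
    finally show ?thesis using i fin by simp
  next
    case False
    then have "(i, j) \<notin> F" for j by force
    then show ?thesis using w(2) by simp
  qed
  have col': "(\<Sum>i\<in>R. w (i, j)) = 0" if j: "j \<in> C" "j \<noteq> j0" for j
  proof (cases "j \<in> snd ` F")
    case True
    then have "0 = (\<Sum>i\<in>R. \<Sum>j'\<in>C. a (Inr j) (i, j') * w (i, j'))"
      using j by (intro ext[symmetric]) (auto simp: cons_def)
    also have "\<dots> = (\<Sum>i\<in>R. \<Sum>j'\<in>C. if j' = j then w (i, j') else 0)"
      by (intro sum.cong) (auto simp: a_def)
    finally show ?thesis using j fin by simp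
  next
    case False
    then have "(i, j) \<notin> F" for i by force
    then show ?thesis using w(2) by simp
  qed
  have col: "(\<Sum>i\<in>R. w (i, j)) = 0" if "j \<in> C" for j
  proof (cases "j = j0")
    case True
    have "0 = (\<Sum>i\<in>R. \<Sum>j\<in>C. w (i, j))" by (simp add: row)
    also have "\<dots> = (\<Sum>j\<in>C. \<Sum>i\<in>R. w (i, j))" by (rule sum.swap)
    also have "\<dots> = (\<Sum>i\<in>R. w (i, j0)) + (\<Sum>j\<in>C - {j0}. \<Sum>i\<in>R. w (i, j))"
      using fin frac by (intro sum.remove) auto
    also have "(\<Sum>j\<in>C - {j0}. \<Sum>i\<in>R. w (i, j)) = 0" by (simp add: col')
    finally show ?thesis using True by simp
  qed (use col' that in auto)
  show ?thesis
  proof (rule that[of "\<lambda>i j. w (i, j)"])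
    show "\<exists>i\<in>R. \<exists>j\<in>C. w (i, j) \<noteq> 0" using w(1) by (auto simp: F_def)
    show "w (i, j) = 0" if "x i j \<in> \<int>" for i j using w(2) that by (auto simp: F_def)
  qed (auto simp: row col)
qed

text \<open>Move along a circulation supported on the fractional entries, with the sign that does
  not lower the objective, until some entry becomes integral; the number of fractional entries
  drops. That integral entries never change is part of the conclusion because it later keeps the
  zero corner of a padded matrix at zero.\<close>

lemma transportation_integrality:
  fixes x c :: "'r \<Rightarrow> 'c \<Rightarrow> real"
  assumes fin: "finite R" "finite C"
    and "\<And>i j. i \<in> R \<Longrightarrow> j \<in> C \<Longrightarrow> 0 \<le> x i j"
    and "\<And>i. i \<in> R \<Longrightarrow> (\<Sum>j\<in>C. x i j) \<in> \<int>"
    and "\<And>j. j \<in> C \<Longrightarrow> (\<Sum>i\<in>R. x i j) \<in> \<int>"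
  shows "\<exists>y. (\<forall>i\<in>R. \<forall>j\<in>C. y i j \<in> \<int> \<and> 0 \<le> y i j \<and> (x i j \<in> \<int> \<longrightarrow> y i j = x i j)) \<and>
    (\<forall>i\<in>R. (\<Sum>j\<in>C. y i j) = (\<Sum>j\<in>C. x i j)) \<and> (\<forall>j\<in>C. (\<Sum>i\<in>R. y i j) = (\<Sum>i\<in>R. x i j)) \<and>
    (\<Sum>i\<in>R. \<Sum>j\<in>C. c i j * x i j) \<le> (\<Sum>i\<in>R. \<Sum>j\<in>C. c i j * y i j)"
  using assms(3-)
proof (induction "card {(i, j) \<in> R \<times> C. x i j \<notin> \<int>}" arbitrary: x rule: less_induct)
  case (less x)
  define F where "F x = {(i, j) \<in> R \<times> C. x i j \<notin> \<int>}" for x :: "'r \<Rightarrow> 'c \<Rightarrow> real"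
  have F: "finite (F x)" for x
    by (rule finite_subset[OF _ finite_cartesian_product[OF fin]]) (auto simp: F_def)
  show ?case
  proof (cases "\<forall>i\<in>R. \<forall>j\<in>C. x i j \<in> \<int>")
    case True
    then show ?thesis using less.prems by (intro exI[of _ x]) auto
  next
    case False
    then obtain i0 j0 where "i0 \<in> R" "j0 \<in> C" "x i0 j0 \<notin> \<int>" by auto
    from fractional_circulation[OF fin less.prems(2,3) this] obtain z' where
      z': "\<exists>i\<in>R. \<exists>j\<in>C. z' i j \<noteq> 0" "\<And>i j. x i j \<in> \<int> \<Longrightarrow> z' i j = 0"
      "\<And>i. i \<in> R \<Longrightarrow> (\<Sum>j\<in>C. z' i j) = (0::real)" "\<And>j. j \<in> C \<Longrightarrow> (\<Sum>i\<in>R. z' i j) = 0"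
      by blast
    obtain z where z: "\<exists>i\<in>R. \<exists>j\<in>C. z i j \<noteq> 0" "\<And>i j. x i j \<in> \<int> \<Longrightarrow> z i j = 0"
      "\<And>i. i \<in> R \<Longrightarrow> (\<Sum>j\<in>C. z i j) = (0::real)" "\<And>j. j \<in> C \<Longrightarrow> (\<Sum>i\<in>R. z i j) = 0"
      and cz: "0 \<le> (\<Sum>i\<in>R. \<Sum>j\<in>C. c i j * z i j)"
    proof (cases "0 \<le> (\<Sum>i\<in>R. \<Sum>j\<in>C. c i j * z' i j)")
      case True
      then show ?thesis using that[of z'] z' by blast
    next
      case False
      then show ?thesis using that[of "\<lambda>i j. - z' i j"] z' by (auto simp: sum_negf)
    qed
    define S where "S = {(i, j) \<in> R \<times> C. z i j \<noteq> 0}"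
    have S: "finite S"
      by (rule finite_subset[OF _ finite_cartesian_product[OF fin]]) (auto simp: S_def)
    \<comment> \<open>The step length at which entry (i, j) reaches the next integer in the
      direction of \<open>z\<close>; \<open>t\<close> is the first such time.\<close>
    define \<tau> where "\<tau> i j = ((if z i j > 0 then of_int \<lceil>x i j\<rceil> else of_int \<lfloor>x i j\<rfloor>) - x i j) / z i j"
      for i j
    define t where "t = Min (case_prod \<tau> ` S)"
    define y where "y i j = x i j + t * z i j" for i j
    have "t \<in> case_prod \<tau> ` S" unfolding t_def using S z(1) by (intro Min_in) (auto simp: S_def)
    then obtain i1 j1 where e1: "(i1, j1) \<in> S" "t = \<tau> i1 j1" by auto
    have t_le: "t \<le> \<tau> i j" if "(i, j) \<in> S" for i j
      unfolding t_def using S that by (intro Min_le) force+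
    have \<tau>_nonneg: "0 \<le> \<tau> i j" for i j
      by (auto simp: \<tau>_def divide_simps)
    have t: "0 \<le> t" using e1 \<tau>_nonneg by simp
    \<comment> \<open>Stopping at time \<open>t\<close> keeps decreasing entries above their floors,
      and floors of nonnegative numbers are nonnegative.\<close>
    have floor_le: "of_int \<lfloor>x i j\<rfloor> \<le> y i j" if "i \<in> R" "j \<in> C" for i j
    proof (cases "z i j < 0")
      case True
      then have "t * z i j \<ge> \<tau> i j * z i j"
        using t_le[of i j] that by (intro mult_right_mono_neg) (auto simp: S_def)
      then show ?thesis using True by (simp add: y_def \<tau>_def)
    next
      case False
      then have "t * z i j \<ge> 0" using t by simp
      then show ?thesis by (simp add: y_def) linarith
    qed
    have y_nonneg: "0 \<le> y i j" if "i \<in> R" "j \<in> C" for i j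
    proof -
      have "0 \<le> real_of_int \<lfloor>x i j\<rfloor>" using less.prems(1)[OF that] by simp
      then show ?thesis using floor_le[OF that] by linarith
    qed
    have y1: "y i1 j1 \<in> \<int>" using e1 by (auto simp: y_def \<tau>_def S_def)
    have y_same: "y i j = x i j" if "x i j \<in> \<int>" for i j
      using z(2)[OF that] by (simp add: y_def)
    have "F y \<subset> F x"
    proof
      show "F y \<subseteq> F x" using y_same by (auto simp: F_def)
      have "(i1, j1) \<in> F x" using e1 z(2) by (auto simp: F_def S_def)
      moreover have "(i1, j1) \<notin> F y" using y1 by (auto simp: F_def)
      ultimately show "F y \<noteq> F x" by auto
    qed
    then have card: "card (F y) < card (F x)" using F by (intro psubset_card_mono)
    have rows: "(\<Sum>j\<in>C. y i j) = (\<Sum>j\<in>C. x i j)" if "i \<in> R" for i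
      using z(3)[OF that] by (simp add: y_def sum.distrib sum_distrib_left[symmetric])
    have cols: "(\<Sum>i\<in>R. y i j) = (\<Sum>i\<in>R. x i j)" if "j \<in> C" for j
      using z(4)[OF that] by (simp add: y_def sum.distrib sum_distrib_left[symmetric])
    have cost: "(\<Sum>i\<in>R. \<Sum>j\<in>C. c i j * x i j) \<le> (\<Sum>i\<in>R. \<Sum>j\<in>C. c i j * y i j)"
    proof -
      have "(\<Sum>i\<in>R. \<Sum>j\<in>C. c i j * y i j) =
          (\<Sum>i\<in>R. \<Sum>j\<in>C. c i j * x i j) + t * (\<Sum>i\<in>R. \<Sum>j\<in>C. c i j * z i j)"
        by (simp add: y_def sum.distrib sum_distrib_left algebra_simps)
      then show ?thesis using t cz by simp
    qed
    obtain w where w: "\<forall>i\<in>R. \<forall>j\<in>C. w i j \<in> \<int> \<and> 0 \<le> w i j \<and> (y i j \<in> \<int> \<longrightarrow> w i j = y i j)"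
      "\<forall>i\<in>R. (\<Sum>j\<in>C. w i j) = (\<Sum>j\<in>C. y i j)" "\<forall>j\<in>C. (\<Sum>i\<in>R. w i j) = (\<Sum>i\<in>R. y i j)"
      "(\<Sum>i\<in>R. \<Sum>j\<in>C. c i j * y i j) \<le> (\<Sum>i\<in>R. \<Sum>j\<in>C. c i j * w i j)"
      using less.hyps[of y, OF card[unfolded F_def] y_nonneg] less.prems(2,3)
      by (auto simp: rows cols)
    show ?thesis
      using w rows cols cost y_same by (intro exI[of _ w]) fastforce
  qed
qed

text \<open>Integrality of the polytope without mention of extreme points: each objective
  \<open>c\<close> is treated separately. The costs \<open>c'\<close> vanish on the slack row and
  column.\<close>

lemma doubly_substochastic_le_partial_perm:
  fixes c :: "nat \<Rightarrow> nat \<Rightarrow> real"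
  assumes X: "X \<in> doubly_substochastic_mats m n K"
  obtains P where "P \<in> partial_perm_mats m n K"
    "(\<Sum>i<m. \<Sum>j<n. c i j * X $$ (i, j)) \<le> (\<Sum>i<m. \<Sum>j<n. c i j * P $$ (i, j))"
proof -
  \<comment> \<open>Row \<open>m\<close> and column \<open>n\<close> collect the slacks, so that all margins become integers. The zero
    corner is an integer, hence stays zero, which preserves the total mass \<open>K\<close>.\<close>
  define x where "x i j = (if i < m \<and> j < n then X $$ (i, j)
     else if i < m then 1 - (\<Sum>j<n. X $$ (i, j))
     else if j < n then 1 - (\<Sum>i<m. X $$ (i, j)) else 0)" for i j
  define c' where "c' i j = (if i < m \<and> j < n then c i j else 0)" for i j
  have nonneg: "0 \<le> x i j" for i j
    using X by (auto simp: x_def doubly_substochastic_mats_def)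
  have total: "(\<Sum>i<m. \<Sum>j<n. X $$ (i, j)) = real K"
    using X by (auto simp: doubly_substochastic_mats_def)
  have row: "(\<Sum>j\<le>n. x i j) = (if i < m then 1 else real n - real K)" for i
  proof -
    have "(\<Sum>j<n. \<Sum>i<m. X $$ (i, j)) = real K" using total by (subst sum.swap)
    then show ?thesis by (simp add: lessThan_Suc_atMost[symmetric] x_def sum_subtractf)
  qed
  have col: "(\<Sum>i\<le>m. x i j) = (if j < n then 1 else real m - real K)" for j
    using total by (simp add: lessThan_Suc_atMost[symmetric] x_def sum_subtractf)
  have int: "(\<Sum>j\<le>n. x i j) \<in> \<int>" "(\<Sum>i\<le>m. x i j) \<in> \<int>" for i j
    by (auto simp: row col)
  from transportation_integrality[of "{..m}" "{..n}" x c',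
      OF finite_atMost finite_atMost nonneg int] obtain y where
    y: "\<forall>i\<in>{..m}. \<forall>j\<in>{..n}. y i j \<in> \<int> \<and> 0 \<le> y i j \<and> (x i j \<in> \<int> \<longrightarrow> y i j = x i j)"
      "\<forall>i\<in>{..m}. (\<Sum>j\<le>n. y i j) = (\<Sum>j\<le>n. x i j)"
      "\<forall>j\<in>{..n}. (\<Sum>i\<le>m. y i j) = (\<Sum>i\<le>m. x i j)"
      "(\<Sum>i\<le>m. \<Sum>j\<le>n. c' i j * x i j) \<le> (\<Sum>i\<le>m. \<Sum>j\<le>n. c' i j * y i j)" by blast
  have y_Int: "y i j \<in> \<int>" and y_nonneg: "0 \<le> y i j" and y_eq: "x i j \<in> \<int> \<Longrightarrow> y i j = x i j"
    if "i \<le> m" "j \<le> n" for i j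
    using y(1) that by auto
  have rowy: "(\<Sum>j<n. y i j) + y i n = 1" if "i < m" for i
  proof -
    have "(\<Sum>j\<le>n. y i j) = 1" using y(2) that by (simp add: row)
    then show ?thesis by (simp add: lessThan_Suc_atMost[symmetric])
  qed
  have coly: "(\<Sum>i<m. y i j) + y m j = 1" if "j < n" for j
  proof -
    have "(\<Sum>i\<le>m. y i j) = 1" using y(3) that by (simp add: col)
    then show ?thesis by (simp add: lessThan_Suc_atMost[symmetric])
  qed
  have y01: "y i j \<in> {0, 1}" if "i < m" "j < n" for i j
  proof -
    have "y i j \<le> (\<Sum>j<n. y i j)" using that by (intro member_le_sum) (auto intro: y_nonneg)
    also have "\<dots> \<le> 1" using rowy[OF that(1)] y_nonneg[of i n] that by simp
    finally have "y i j \<le> 1" .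
    moreover have "0 \<le> y i j" using y_nonneg that by simp
    moreover have "y i j \<in> \<int>" using y_Int that by simp
    then obtain k where "y i j = of_int k" by (rule Ints_cases)
    ultimately have "0 \<le> k" "k \<le> 1" "y i j = of_int k" by simp_all
    moreover from this have "k = 0 \<or> k = 1" by linarith
    ultimately show ?thesis by auto
  qed
  have card_eq: "real (card {j \<in> B. f j = 1}) = sum f B" if "\<And>j. j \<in> B \<Longrightarrow> f j \<in> {0, 1}" "finite B"
    for f :: "'z \<Rightarrow> real" and B
  proof -
    have "sum f B = (\<Sum>j\<in>B. of_bool (f j = 1))" using that by (intro sum.cong) auto
    then show ?thesis using that(2) by (simp add: Int_def)
  qed
  have totaly: "(\<Sum>i<m. \<Sum>j<n. y i j) = real K"
  proof -
    have "y m n = 0" using y_eq[of m n] by (simp add: x_def)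
    moreover have "(\<Sum>i<m. y i n) + y m n = real m - real K"
    proof -
      have "(\<Sum>i\<le>m. y i n) = real m - real K" using y(3) by (simp add: col)
      then show ?thesis by (simp add: lessThan_Suc_atMost[symmetric])
    qed
    moreover have "(\<Sum>i<m. (\<Sum>j<n. y i j) + y i n) = real m" by (simp add: rowy)
    ultimately show ?thesis by (simp add: sum.distrib)
  qed
  define P where "P = mat m n (\<lambda>(i, j). y i j)"
  have "P \<in> partial_perm_mats m n K"
    unfolding partial_perm_mats_def
  proof (intro CollectI conjI allI impI)
    show "P \<in> carrier_mat m n" by (simp add: P_def)
    show "P $$ (i, j) \<in> {0, 1}" if "i < m" "j < n" for i j
      using y01 that by (simp add: P_def)
    show "card {j. j < n \<and> P $$ (i, j) = 1} \<le> 1" if i: "i < m" for i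
    proof -
      have "{j. j < n \<and> P $$ (i, j) = 1} = {j \<in> {..<n}. y i j = 1}" using i by (auto simp: P_def)
      moreover have "real (card {j \<in> {..<n}. y i j = 1}) \<le> 1"
        using rowy[OF i] y_nonneg[of i n] i by (subst card_eq) (use y01 i in auto)
      ultimately show ?thesis by simp
    qed
    show "card {i. i < m \<and> P $$ (i, j) = 1} \<le> 1" if j: "j < n" for j
    proof -
      have "{i. i < m \<and> P $$ (i, j) = 1} = {i \<in> {..<m}. y i j = 1}" using j by (auto simp: P_def)
      moreover have "real (card {i \<in> {..<m}. y i j = 1}) \<le> 1"
        using coly[OF j] y_nonneg[of m j] j by (subst card_eq) (use y01 j in auto)
      ultimately show ?thesis by simp
    qed
    have "{(i, j). i < m \<and> j < n \<and> P $$ (i, j) = 1} =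
        {e \<in> {..<m} \<times> {..<n}. case_prod y e = 1}" by (auto simp: P_def)
    also have "real (card \<dots>) = (\<Sum>e\<in>{..<m} \<times> {..<n}. case_prod y e)"
      by (subst card_eq) (use y01 in auto)
    also have "\<dots> = real K" using totaly by (simp add: sum.cartesian_product)
    finally show "card {(i, j). i < m \<and> j < n \<and> P $$ (i, j) = 1} = K" by simp
  qed
  moreover have "(\<Sum>i<m. \<Sum>j<n. c i j * X $$ (i, j)) \<le> (\<Sum>i<m. \<Sum>j<n. c i j * P $$ (i, j))"
    using y(4) by (simp add: lessThan_Suc_atMost[symmetric] c'_def x_def P_def)
  ultimately show ?thesis using that by blast
qed

subsection \<open>Reduction to pairs of partial matchings\<close>

definition partial_matchings :: "nat \<Rightarrow> nat \<Rightarrow> nat \<Rightarrow> (nat \<times> nat) set set" where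
  "partial_matchings m n K =
     {S. S \<subseteq> {..<m} \<times> {..<n} \<and> inj_on fst S \<and> inj_on snd S \<and> card S = K}"

definition diagonal :: "nat \<Rightarrow> (nat \<times> nat) set" where
  "diagonal K = (\<lambda>i. (i, i)) ` {..<K}"

definition mat_support :: "real mat \<Rightarrow> (nat \<times> nat) set" where
  "mat_support P = {(i, j). i < dim_row P \<and> j < dim_col P \<and> P $$ (i, j) = 1}"

lemma finite_partial_matchings: "finite (partial_matchings m n K)"
  by (rule finite_subset[of _ "Pow ({..<m} \<times> {..<n})"]) (auto simp: partial_matchings_def)

lemma finite_partial_matching: "S \<in> partial_matchings m n K \<Longrightarrow> finite S"
  by (auto simp: partial_matchings_def intro: finite_subset[of _ "{..<m} \<times> {..<n}"])

lemma card_diagonal [simp]: "card (diagonal K) = K"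
  by (simp add: diagonal_def card_image inj_on_def)

lemma diagonal_in_partial_matchings:
  "K \<le> m \<Longrightarrow> K \<le> n \<Longrightarrow> diagonal K \<in> partial_matchings m n K"
  by (auto simp: partial_matchings_def diagonal_def inj_on_def card_image)

lemma inj_on_fst_card:
  assumes "\<And>i. i < m \<Longrightarrow> card {j. j < n \<and> Q i j} \<le> 1"
  shows "inj_on fst {(i, j). i < (m::nat) \<and> j < (n::nat) \<and> Q i j}"
proof (rule inj_onI, clarsimp)
  fix i j j' assume *: "i < m" "j < n" "Q i j" "j' < n" "Q i j'"
  have "card {j, j'} \<le> card {j. j < n \<and> Q i j}" using * by (intro card_mono) auto
  with assms[OF *(1)] have "card {j, j'} \<le> 1" by simp
  then show "j = j'" by (cases "j = j'") auto
qed

lemma mat_support_partial_perm: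
  assumes P: "P \<in> partial_perm_mats m n K"
  shows "mat_support P \<in> partial_matchings m n K"
    and "\<And>e. e \<in> {..<m} \<times> {..<n} \<Longrightarrow> P $$ e = of_bool (e \<in> mat_support P)"
proof -
  have dim: "dim_row P = m" "dim_col P = n" using P by (auto simp: partial_perm_mats_def)
  have "inj_on fst (mat_support P)"
    unfolding mat_support_def dim
    by (rule inj_on_fst_card) (use P in \<open>simp add: partial_perm_mats_def\<close>)
  moreover have "inj_on snd (mat_support P)"
  proof -
    have "inj_on fst {(j, i). j < n \<and> i < m \<and> P $$ (i, j) = 1}"
      by (rule inj_on_fst_card) (use P in \<open>simp add: partial_perm_mats_def\<close>)
    then show ?thesis by (auto simp: inj_on_def mat_support_def dim)
  qed
  moreover have "card (mat_support P) = K"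
    using P by (simp add: partial_perm_mats_def mat_support_def dim)
  ultimately show "mat_support P \<in> partial_matchings m n K"
    by (auto simp: partial_matchings_def mat_support_def dim)
  show "P $$ e = of_bool (e \<in> mat_support P)" if "e \<in> {..<m} \<times> {..<n}" for e
  proof -
    obtain i j where e: "e = (i, j)" "i < m" "j < n" using \<open>e \<in> _\<close> by auto
    then have "P $$ (i, j) \<in> {0, 1}" using P unfolding partial_perm_mats_def by blast
    then show ?thesis using e by (auto simp: mat_support_def dim)
  qed
qed

lemma sum_partial_perm:
  assumes P: "P \<in> partial_perm_mats m n K"
  shows "(\<Sum>e\<in>{..<m} \<times> {..<n}. g e * P $$ e) = (\<Sum>e\<in>mat_support P. g e)"
proof -
  have "(\<Sum>e\<in>{..<m} \<times> {..<n}. g e * P $$ e) =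
      (\<Sum>e\<in>{..<m} \<times> {..<n}. if e \<in> mat_support P then g e else 0)"
    using mat_support_partial_perm(2)[OF P] by (intro sum.cong) auto
  also have "\<dots> = (\<Sum>e\<in>({..<m} \<times> {..<n}) \<inter> mat_support P. g e)"
    by (rule sum.inter_restrict[symmetric]) simp
  also have "({..<m} \<times> {..<n}) \<inter> mat_support P = mat_support P"
    using mat_support_partial_perm(1)[OF P] by (auto simp: partial_matchings_def)
  finally show ?thesis .
qed

lemma core_identity_mat_index:
  assumes "K \<le> m" "K \<le> n"
  shows "core_identity_mat m n K \<in> carrier_mat m n"
    and "\<And>i j. i < m \<Longrightarrow> j < n \<Longrightarrow>
      core_identity_mat m n K $$ (i, j) = of_bool ((i, j) \<in> diagonal K)"
  using assms by (auto simp: core_identity_mat_def diagonal_def)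

lemma core_in_partial_perm_mats:
  assumes "K \<le> m" "K \<le> n"
  shows "core_identity_mat m n K \<in> partial_perm_mats m n K"
    and "mat_support (core_identity_mat m n K) = diagonal K"
proof -
  let ?C = "core_identity_mat m n K"
  note C = core_identity_mat_index[OF assms]
  have dim: "dim_row ?C = m" "dim_col ?C = n" using C(1) by auto
  have "(i < m \<and> j < n \<and> ?C $$ (i, j) = 1) \<longleftrightarrow> (i, j) \<in> diagonal K" for i j
    using C(2)[of i j] assms by (auto simp: diagonal_def)
  note iff = this
  then show supp: "mat_support ?C = diagonal K" by (auto simp: mat_support_def dim)
  have "card {j. j < n \<and> ?C $$ (i, j) = 1} \<le> 1" if "i < m" for i
  proof -
    have "{j. j < n \<and> ?C $$ (i, j) = 1} \<subseteq> {i}" using iff[of i] that by (auto simp: diagonal_def)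
    then have "card {j. j < n \<and> ?C $$ (i, j) = 1} \<le> card {i}" by (intro card_mono) auto
    then show ?thesis by simp
  qed
  moreover have "card {i. i < m \<and> ?C $$ (i, j) = 1} \<le> 1" if "j < n" for j
  proof -
    have "{i. i < m \<and> ?C $$ (i, j) = 1} \<subseteq> {j}" using iff[of _ j] that by (auto simp: diagonal_def)
    then have "card {i. i < m \<and> ?C $$ (i, j) = 1} \<le> card {j}" by (intro card_mono) auto
    then show ?thesis by simp
  qed
  ultimately show "?C \<in> partial_perm_mats m n K"
    using C by (auto simp: partial_perm_mats_def iff)
qed

lemma partial_perm_subset_substochastic:
  "partial_perm_mats m n K \<subseteq> doubly_substochastic_mats m n K"
proof
  fix P assume P: "P \<in> partial_perm_mats m n K"
  have P01: "P $$ (i, j) = of_bool (P $$ (i, j) = 1)" if "i < m" "j < n" for i j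
  proof -
    have "P $$ (i, j) \<in> {0, 1}" using P that unfolding partial_perm_mats_def by blast
    then show ?thesis by auto
  qed
  have row: "(\<Sum>j<n. P $$ (i, j)) = real (card {j. j < n \<and> P $$ (i, j) = 1})" if "i < m" for i
  proof -
    have "(\<Sum>j<n. P $$ (i, j)) = (\<Sum>j<n. of_bool (P $$ (i, j) = 1))"
      using P01 that by (intro sum.cong) auto
    then show ?thesis by (simp add: Int_def)
  qed
  have col: "(\<Sum>i<m. P $$ (i, j)) = real (card {i. i < m \<and> P $$ (i, j) = 1})" if "j < n" for j
  proof -
    have "(\<Sum>i<m. P $$ (i, j)) = (\<Sum>i<m. of_bool (P $$ (i, j) = 1))"
      using P01 that by (intro sum.cong) auto
    then show ?thesis by (simp add: Int_def)
  qed
  have "(\<Sum>i<m. \<Sum>j<n. P $$ (i, j)) = (\<Sum>e\<in>{..<m} \<times> {..<n}. 1 * P $$ e)"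
    by (simp add: sum.cartesian_product')
  also have "\<dots> = real K"
    unfolding sum_partial_perm[OF P]
    using mat_support_partial_perm(1)[OF P] by (simp add: partial_matchings_def)
  finally have total: "(\<Sum>i<m. \<Sum>j<n. P $$ (i, j)) = real K" .
  have "0 \<le> P $$ (i, j)" if "i < m" "j < n" for i j
    by (subst P01[OF that]) simp
  then show "P \<in> doubly_substochastic_mats m n K"
    using P row col total by (simp add: doubly_substochastic_mats_def partial_perm_mats_def)
qed

section \<open>Strictness, and the passage from matchings to the polytope\<close>

text \<open>Finitely many strict inequalities leave room for a common small perturbation; in
  \<open>quadratic_less_core\<close>, \<open>h\<close> counts index pairs off the diagonal.\<close>

lemma uniform_gap:
  fixes g h :: "'t \<Rightarrow> real"
  assumes "finite T" "\<And>t. t \<in> T \<Longrightarrow> 0 < g t" "\<And>t. t \<in> T \<Longrightarrow> 0 \<le> h t"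
  shows "\<exists>\<delta>>0. \<forall>t\<in>T. \<delta> * h t \<le> g t"
  using assms
proof (induction T rule: finite_induct)
  case empty
  then show ?case by (auto intro: exI[of _ 1])
next
  case (insert t T)
  then obtain \<delta> where \<delta>: "\<delta> > 0" "\<forall>t\<in>T. \<delta> * h t \<le> g t" by auto
  \<comment> \<open>The summand 1 keeps the denominator positive when \<open>h t\<close> =
    0.\<close>
  define \<delta>' where "\<delta>' = min \<delta> (g t / (h t + 1))"
  have ht: "0 \<le> h t" and gt: "0 < g t" using insert.prems by auto
  have "\<delta>' > 0" using \<delta> ht gt by (auto simp: \<delta>'_def)
  moreover have "\<delta>' * h t \<le> g t"
  proof -
    have "\<delta>' * h t \<le> g t / (h t + 1) * h t" using ht by (intro mult_right_mono) (auto simp: \<delta>'_def)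
    also have "\<dots> \<le> g t" using ht gt by (simp add: divide_simps)
    finally show ?thesis .
  qed
  moreover have "\<delta>' * h s \<le> g s" if "s \<in> T" for s
  proof -
    have "\<delta>' * h s \<le> \<delta> * h s"
      using insert.prems(2)[of s] that by (intro mult_right_mono) (auto simp: \<delta>'_def)
    then show ?thesis using \<delta>(2) that by force
  qed
  ultimately show ?case by auto
qed

lemma mat_trace_quadratic:
  fixes A B X :: "real mat"
  assumes "A \<in> carrier_mat m m" "B \<in> carrier_mat n n" "X \<in> carrier_mat m n"
  shows "mat_trace (A * X * B * transpose_mat X) =
    (\<Sum>u\<in>{..<m} \<times> {..<n}. \<Sum>v\<in>{..<m} \<times> {..<n}.
       (A $$ (fst u, fst v) * B $$ (snd v, snd u)) * X $$ u * X $$ v)"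
proof -
  have "mat_trace (A * X * B * transpose_mat X) =
      (\<Sum>i<m. \<Sum>j<n. (\<Sum>i'<m. A $$ (i, i') * (\<Sum>j'<n. X $$ (i', j') * B $$ (j', j))) * X $$ (i, j))"
    using assms by (simp add: mat_trace_def scalar_prod_def lessThan_atLeast0)
  also have "\<dots> = (\<Sum>i<m. \<Sum>j<n. \<Sum>i'<m. \<Sum>j'<n.
      (A $$ (i, i') * B $$ (j', j)) * X $$ (i, j) * X $$ (i', j'))"
    by (intro sum.cong refl) (simp add: sum_distrib_right sum_distrib_left mult_ac)
  finally show ?thesis by (simp add: sum.cartesian_product')
qed

text \<open>With one argument frozen the form is linear in the other, so each copy of
  \<open>X\<close> can be replaced by a matching. This gives only a weak inequality, so a reward
  \<delta> for off-diagonal mass is added before the second replacement; the uniform gap pays for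
  it, and what remains is a loss of \<delta> times the off-diagonal mass of \<open>X\<close>, which
  is positive unless \<open>X\<close> is the core.\<close>

lemma quadratic_less_core:
  fixes q :: "nat \<times> nat \<Rightarrow> nat \<times> nat \<Rightarrow> real"
  assumes K: "K \<le> m" "K \<le> n"
    and less: "\<And>S S'. S \<in> partial_matchings m n K \<Longrightarrow> S' \<in> partial_matchings m n K \<Longrightarrow>
      (S, S') \<noteq> (diagonal K, diagonal K) \<Longrightarrow>
      (\<Sum>u\<in>S. \<Sum>v\<in>S'. q u v) < (\<Sum>u\<in>diagonal K. \<Sum>v\<in>diagonal K. q u v)"
    and X: "X \<in> doubly_substochastic_mats m n K" "X \<noteq> core_identity_mat m n K"
  shows "(\<Sum>u\<in>{..<m} \<times> {..<n}. \<Sum>v\<in>{..<m} \<times> {..<n}. q u v * X $$ u * X $$ v)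
    < (\<Sum>u\<in>diagonal K. \<Sum>v\<in>diagonal K. q u v)"
proof -
  let ?J = "{..<m} \<times> {..<n}" and ?D = "diagonal K"
  define val where "val S S' = (\<Sum>u\<in>S. \<Sum>v\<in>S'. q u v)" for S S'
  define off where "off e = (of_bool (e \<notin> ?D) :: real)" for e
  have lp: "\<exists>S\<in>partial_matchings m n K. (\<Sum>e\<in>?J. g e * X $$ e) \<le> sum g S" for g
  proof -
    obtain P where P: "P \<in> partial_perm_mats m n K"
      "(\<Sum>i<m. \<Sum>j<n. g (i, j) * X $$ (i, j)) \<le> (\<Sum>i<m. \<Sum>j<n. g (i, j) * P $$ (i, j))"
      using doubly_substochastic_le_partial_perm[OF X(1), of "\<lambda>i j. g (i, j)"] by blast
    have "(\<Sum>i<m. \<Sum>j<n. g (i, j) * P $$ (i, j)) = (\<Sum>e\<in>?J. g e * P $$ e)"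
      by (rule sum.cartesian_product'[symmetric])
    also have "\<dots> = sum g (mat_support P)" by (rule sum_partial_perm[OF P(1)])
    finally show ?thesis
      using P(2) mat_support_partial_perm(1)[OF P(1)]
      by (intro bexI[of _ "mat_support P"]) (simp_all add: sum.cartesian_product')
  qed
  define pairs where
    "pairs = partial_matchings m n K \<times> partial_matchings m n K - {(?D, ?D)}"
  have "finite pairs" unfolding pairs_def using finite_partial_matchings by blast
  then have "\<exists>\<delta>>0. \<forall>t\<in>pairs. \<delta> * sum off (fst t) \<le> val ?D ?D - val (fst t) (snd t)"
  proof (rule uniform_gap)
    show "0 < val ?D ?D - val (fst t) (snd t)" if "t \<in> pairs" for t
      using less[of "fst t" "snd t"] that by (auto simp: pairs_def val_def)
    show "0 \<le> sum off (fst t)" for t :: "(nat \<times> nat) set \<times> (nat \<times> nat) set"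
      by (intro sum_nonneg) (simp add: off_def)
  qed
  then obtain \<delta> where \<delta>: "\<delta> > 0"
    "\<And>S S'. (S, S') \<in> pairs \<Longrightarrow> \<delta> * sum off S \<le> val ?D ?D - val S S'"
    by fastforce
  have val_le: "val S S' + \<delta> * sum off S \<le> val ?D ?D"
    if "S \<in> partial_matchings m n K" "S' \<in> partial_matchings m n K" for S S'
  proof (cases "(S, S') = (?D, ?D)")
    case True
    then show ?thesis by (simp add: off_def)
  next
    case False
    then show ?thesis using \<delta>(2)[of S S'] that by (auto simp: pairs_def)
  qed
  \<comment> \<open>\<open>S'\<close> must come first: it fixes the objective for which
    \<open>S\<close> is then chosen.\<close>
  obtain S' where S': "S' \<in> partial_matchings m n K"
    "(\<Sum>v\<in>?J. (\<Sum>u\<in>?J. q u v * X $$ u) * X $$ v) \<le> (\<Sum>v\<in>S'. \<Sum>u\<in>?J. q u v * X $$ u)"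
    using lp[of "\<lambda>v. \<Sum>u\<in>?J. q u v * X $$ u"] by blast
  obtain S where S: "S \<in> partial_matchings m n K"
    "(\<Sum>u\<in>?J. ((\<Sum>v\<in>S'. q u v) + \<delta> * off u) * X $$ u) \<le> (\<Sum>u\<in>S. (\<Sum>v\<in>S'. q u v) + \<delta> * off u)"
    using lp[of "\<lambda>u. (\<Sum>v\<in>S'. q u v) + \<delta> * off u"] by blast
  have "(\<Sum>u\<in>?J. \<Sum>v\<in>?J. q u v * X $$ u * X $$ v) =
      (\<Sum>v\<in>?J. (\<Sum>u\<in>?J. q u v * X $$ u) * X $$ v)"
    by (subst sum.swap) (simp add: sum_distrib_right)
  also have "\<dots> \<le> (\<Sum>v\<in>S'. \<Sum>u\<in>?J. q u v * X $$ u)" by (rule S')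
  also have "\<dots> = (\<Sum>u\<in>?J. (\<Sum>v\<in>S'. q u v) * X $$ u)"
    by (subst sum.swap) (simp add: sum_distrib_right)
  also have "\<dots> = (\<Sum>u\<in>?J. ((\<Sum>v\<in>S'. q u v) + \<delta> * off u) * X $$ u) - \<delta> * (\<Sum>u\<in>?J. off u * X $$ u)"
    by (simp only: distrib_right sum.distrib sum_distrib_left mult.assoc add_diff_cancel_right')
  also have "\<dots> \<le> (val S S' + \<delta> * sum off S) - \<delta> * (\<Sum>u\<in>?J. off u * X $$ u)"
    using S(2) by (simp add: val_def sum.distrib sum_distrib_left)
  also have "\<dots> \<le> val ?D ?D - \<delta> * (\<Sum>u\<in>?J. off u * X $$ u)"
    using val_le[OF S(1) S'(1)] by simp
  also have "\<dots> < val ?D ?D"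
  proof -
    have nonneg: "0 \<le> X $$ u" if "u \<in> ?J" for u
      using X(1) that by (auto simp: doubly_substochastic_mats_def)
    have carr: "X \<in> carrier_mat m n" using X(1) by (simp add: doubly_substochastic_mats_def)
    have le1: "X $$ (i, j) \<le> 1" if "i < m" "j < n" for i j
    proof -
      have "X $$ (i, j) \<le> (\<Sum>j<n. X $$ (i, j))"
        using that nonneg by (intro member_le_sum) auto
      also have "\<dots> \<le> 1" using X(1) that by (auto simp: doubly_substochastic_mats_def)
      finally show ?thesis .
    qed
    \<comment> \<open>Otherwise the total mass K sits on K diagonal entries, each at most 1, so all
      of them equal 1 and \<open>X\<close> is the core.\<close>
    have "0 < (\<Sum>u\<in>?J. off u * X $$ u)"
    proof (rule ccontr)
      assume "\<not> ?thesis"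
      moreover have "0 \<le> (\<Sum>u\<in>?J. off u * X $$ u)"
        by (intro sum_nonneg mult_nonneg_nonneg nonneg) (auto simp: off_def)
      ultimately have "(\<Sum>u\<in>?J. off u * X $$ u) = 0" by simp
      then have zero: "off u * X $$ u = 0" if "u \<in> ?J" for u
        using that nonneg by (subst (asm) sum_nonneg_eq_0_iff) (auto simp: off_def)
      have subD: "?D \<subseteq> ?J" using K by (auto simp: diagonal_def)
      have "real K = (\<Sum>u\<in>?J. X $$ u)"
        using X(1) by (simp add: doubly_substochastic_mats_def sum.cartesian_product')
      also have "\<dots> = (\<Sum>u\<in>?D. X $$ u)"
        using subD zero by (intro sum.mono_neutral_right) (auto simp: off_def)
      finally have "(\<Sum>u\<in>?D. 1 - X $$ u) = 0" by (simp add: sum_subtractf)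
      then have one: "X $$ u = 1" if "u \<in> ?D" for u
        using that subD le1
        by (subst (asm) sum_nonneg_eq_0_iff) (auto simp: diagonal_def)
      have "X = core_identity_mat m n K"
      proof (rule eq_matI)
        let ?C = "core_identity_mat m n K"
        have dimC: "dim_row ?C = m" "dim_col ?C = n" using core_identity_mat_index(1)[OF K] by auto
        show "dim_row X = dim_row ?C" "dim_col X = dim_col ?C" using carr dimC by auto
        fix i j assume "i < dim_row ?C" "j < dim_col ?C"
        then have ij: "i < m" "j < n" using dimC by auto
        then show "X $$ (i, j) = ?C $$ (i, j)"
          using core_identity_mat_index(2)[OF K ij] one[of "(i, j)"] zero[of "(i, j)"]
          by (cases "(i, j) \<in> ?D") (auto simp: off_def)
      qed
      then show False using X(2) by simp
    qed
    then show ?thesis using \<delta>(1) by simp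
  qed
  finally show ?thesis by (simp add: val_def)
qed

lemma argmax_set_unique:
  assumes "x \<in> S" "\<And>y. y \<in> S \<Longrightarrow> y \<noteq> x \<Longrightarrow> f y < f x"
  shows "argmax_set f S = {x}"
  using assms unfolding argmax_set_def is_arg_max_def by (auto dest: less_asym)

text \<open>The value of trace (A X B Z^T) when Z and X are the 0/1 matrices with supports
  \<open>S\<close> and \<open>S'\<close>.\<close>

definition overlap :: "real mat \<Rightarrow> real mat \<Rightarrow> (nat \<times> nat) set \<Rightarrow> (nat \<times> nat) set \<Rightarrow> real" where
  "overlap A B S S' = (\<Sum>u\<in>S. \<Sum>v\<in>S'. A $$ (fst u, fst v) * B $$ (snd v, snd u))"

text \<open>The core lies in the discrete set, which lies in the polytope, so one strict inequality
  on the polytope settles both argmax sets.\<close>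

lemma argmax_trace_eq_core:
  fixes A B :: "real mat"
  assumes K: "K \<le> m" "K \<le> n" and A: "A \<in> carrier_mat m m" and B: "B \<in> carrier_mat n n"
    and less: "\<And>S S'. S \<in> partial_matchings m n K \<Longrightarrow> S' \<in> partial_matchings m n K \<Longrightarrow>
      (S, S') \<noteq> (diagonal K, diagonal K) \<Longrightarrow>
      overlap A B S S' < overlap A B (diagonal K) (diagonal K)"
  defines "f \<equiv> \<lambda>X. mat_trace (A * X * B * transpose_mat X)"
  shows "argmax_set f (partial_perm_mats m n K) = {core_identity_mat m n K}"
    and "argmax_set f (doubly_substochastic_mats m n K) = {core_identity_mat m n K}"
proof -
  let ?C = "core_identity_mat m n K"
  let ?J = "{..<m} \<times> {..<n}" and ?q = "\<lambda>u v. A $$ (fst u, fst v) * B $$ (snd v, snd u)"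
  note C = core_in_partial_perm_mats[OF K]
  have f: "f X = (\<Sum>u\<in>?J. \<Sum>v\<in>?J. ?q u v * X $$ u * X $$ v)" if "X \<in> carrier_mat m n" for X
    unfolding f_def by (rule mat_trace_quadratic[OF A B that])
  have "f ?C = (\<Sum>u\<in>?J. (\<Sum>v\<in>?J. ?q u v * ?C $$ v) * ?C $$ u)"
    using C(1) by (simp add: f partial_perm_mats_def sum_distrib_left sum_distrib_right mult_ac)
  also have "\<dots> = (\<Sum>u\<in>diagonal K. \<Sum>v\<in>diagonal K. ?q u v)"
    by (simp only: sum_partial_perm[OF C(1)] C(2))
  finally have fC: "f ?C = (\<Sum>u\<in>diagonal K. \<Sum>v\<in>diagonal K. ?q u v)" .
  have lt: "f X < f ?C" if "X \<in> doubly_substochastic_mats m n K" "X \<noteq> ?C" for X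
    unfolding fC using quadratic_less_core[OF K less[unfolded overlap_def] that] that
    by (subst f) (auto simp: doubly_substochastic_mats_def)
  show "argmax_set f (doubly_substochastic_mats m n K) = {?C}"
    using C(1) partial_perm_subset_substochastic lt by (intro argmax_set_unique) blast+
  show "argmax_set f (partial_perm_mats m n K) = {?C}"
    using C(1) partial_perm_subset_substochastic lt by (intro argmax_set_unique) blast+
qed

subsection \<open>Edge blocks\<close>

text \<open>Changing block \<open>b\<close> moves the sum by at most twice the number of terms
  reading \<open>b\<close>. Double counting the incidences between blocks and terms bounds the sum
  of squares by 8 d \<open>card T\<close>, so the variance proxy is linear in the number of
  terms.\<close>

lemma (in prob_space) bounded_differences_sum_tail:
  fixes X :: "'i \<Rightarrow> 'a \<Rightarrow> 'c::finite" and g :: "'t \<Rightarrow> ('i \<Rightarrow> 'c) \<Rightarrow> real"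
  assumes fin: "finite I" "finite T" and ind: "indep_vars (\<lambda>_. count_space UNIV) X I"
    and g_bound: "\<And>t x. t \<in> T \<Longrightarrow> \<bar>g t x\<bar> \<le> 1"
    and g_dep: "\<And>t x y. t \<in> T \<Longrightarrow> (\<And>b. b \<in> dep t \<Longrightarrow> x b = y b) \<Longrightarrow> g t x = g t y"
    and dep: "\<And>t. t \<in> T \<Longrightarrow> dep t \<subseteq> I" "\<And>t. t \<in> T \<Longrightarrow> card (dep t) \<le> 2"
    and deg: "\<And>b. b \<in> I \<Longrightarrow> card {t \<in> T. b \<in> dep t} \<le> d" "d > 0"
    and mean: "expectation (\<lambda>\<omega>. \<Sum>t\<in>T. g t (\<lambda>b. X b \<omega>)) \<le> - s" "s > 0" and T: "T \<noteq> {}"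
  shows "{\<omega> \<in> space M. 0 \<le> (\<Sum>t\<in>T. g t (\<lambda>b. X b \<omega>))} \<in> sets M"
    and "prob {\<omega> \<in> space M. 0 \<le> (\<Sum>t\<in>T. g t (\<lambda>b. X b \<omega>))} \<le> exp (- s\<^sup>2 / (4 * d * card T))"
proof -
  define f where "f x = (\<Sum>t\<in>T. g t x)" for x
  define c where "c b = 2 * real (card {t \<in> T. b \<in> dep t})" for b
  have bd: "f (x(b := y)) - f x \<le> c b" if "b \<in> I" for b x y
  proof -
    have "f (x(b := y)) - f x = (\<Sum>t\<in>T. g t (x(b := y)) - g t x)"
      by (simp add: f_def sum_subtractf)
    also have "\<dots> \<le> (\<Sum>t\<in>T. if b \<in> dep t then 2 else 0)"
    proof (rule sum_mono)
      fix t assume t: "t \<in> T"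
      show "g t (x(b := y)) - g t x \<le> (if b \<in> dep t then 2 else 0)"
      proof (cases "b \<in> dep t")
        case True
        then show ?thesis using g_bound[OF t, of x] g_bound[OF t, of "x(b := y)"] by simp
      next
        case False
        then have "g t (x(b := y)) = g t x" by (intro g_dep t) auto
        then show ?thesis by simp
      qed
    qed
    also have "\<dots> = c b" using fin by (simp add: c_def sum.If_cases Int_def)
    finally show ?thesis .
  qed
  have f_dep: "f x = f y" if "\<And>b. b \<in> I \<Longrightarrow> x b = y b" for x y
    unfolding f_def using dep(1) that by (intro sum.cong refl g_dep) auto
  define V where "V = 8 * real d * real (card T)"
  have "V > 0" using T fin deg by (simp add: V_def card_gt_0_iff)
  \<comment> \<open>One factor \<open>c b\<close> is bounded by 2 d; the other is kept for the
    double counting.\<close>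
  have "(\<Sum>b\<in>I. (c b)\<^sup>2) \<le> (\<Sum>b\<in>I. 2 * real d * c b)"
    unfolding power2_eq_square using deg(1) by (intro sum_mono mult_right_mono) (auto simp: c_def)
  also have "\<dots> = 4 * real d * real (\<Sum>b\<in>I. card {t \<in> T. b \<in> dep t})"
    by (simp add: c_def sum_distrib_left mult_ac)
  also have "(\<Sum>b\<in>I. card {t \<in> T. b \<in> dep t}) = (\<Sum>b\<in>I. \<Sum>t\<in>T. of_bool (b \<in> dep t))"
    using fin by (simp add: Int_def)
  also have "\<dots> = (\<Sum>t\<in>T. \<Sum>b\<in>I. of_bool (b \<in> dep t))" by (rule sum.swap)
  also have "\<dots> = (\<Sum>t\<in>T. card (dep t))"
    using fin dep(1) by (intro sum.cong) (auto simp: Int_absorb1)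
  also have "4 * real d * real (\<Sum>t\<in>T. card (dep t)) \<le> 4 * real d * real (\<Sum>t\<in>T. 2)"
    using dep(2) by (intro mult_left_mono of_nat_mono sum_mono) auto
  also have "\<dots> = V" by (simp add: V_def)
  finally have V: "(\<Sum>b\<in>I. (c b)\<^sup>2) \<le> V" .
  \<comment> \<open>The event that the sum is nonnegative is a deviation from the mean by exactly
    \<open>s'\<close>, which is at least \<open>s\<close>.\<close>
  define s' where "s' = - expectation (\<lambda>\<omega>. f (\<lambda>b. X b \<omega>))"
  have s': "s \<le> s'" "s' > 0" using mean by (simp_all add: s'_def f_def)
  note tail = bounded_differences_tail[OF fin(1) ind bd f_dep V \<open>V > 0\<close> s'(2)]
  have eq: "{\<omega> \<in> space M. expectation (\<lambda>\<omega>. f (\<lambda>b. X b \<omega>)) + s' \<le> f (\<lambda>b. X b \<omega>)} =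
      {\<omega> \<in> space M. 0 \<le> (\<Sum>t\<in>T. g t (\<lambda>b. X b \<omega>))}"
    by (simp add: s'_def f_def)
  show "{\<omega> \<in> space M. 0 \<le> (\<Sum>t\<in>T. g t (\<lambda>b. X b \<omega>))} \<in> sets M"
    using tail(1) unfolding eq by simp
  have "prob {\<omega> \<in> space M. 0 \<le> (\<Sum>t\<in>T. g t (\<lambda>b. X b \<omega>))} \<le> exp (- 2 * s'\<^sup>2 / V)"
    using tail(2) unfolding eq by simp
  also have "\<dots> \<le> exp (- 2 * s\<^sup>2 / V)"
    using s' mean(2) \<open>V > 0\<close> by (simp add: divide_right_mono power_mono)
  also have "- 2 * s\<^sup>2 / V = - s\<^sup>2 / (4 * d * card T)"
    by (simp add: V_def)
  finally show "prob {\<omega> \<in> space M. 0 \<le> (\<Sum>t\<in>T. g t (\<lambda>b. X b \<omega>))}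
      \<le> exp (- s\<^sup>2 / (4 * d * card T))" .
qed

text \<open>Matrix indices \<open>i\<close>, \<open>j\<close> count from 0, the vertices in the blocks from 1.\<close>

definition edge_block :: "(nat \<Rightarrow> nat \<Rightarrow> adj_block) \<Rightarrow> nat \<Rightarrow> nat \<Rightarrow> nat \<Rightarrow> adj_block" where
  "edge_block mk K i j =
     (if max i j < K then Common (Suc (min i j)) (Suc (max i j))
      else mk (Suc (min i j)) (Suc (max i j)))"

definition signed_entry :: "nat \<Rightarrow> nat \<Rightarrow> bool \<Rightarrow> real" where
  "signed_entry i j e = (if i = j then 0 else if e then 1 else - 1)"

text \<open>One summand of \<open>overlap\<close> as a function of the independent blocks: the entry
  of A reads the first bit of its block, the entry of B the second bit of its own, and both may read
  the same \<open>Common\<close> block.\<close>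

definition entry_prod ::
    "nat \<Rightarrow> (adj_block \<Rightarrow> bool \<times> bool) \<Rightarrow> nat \<times> nat \<Rightarrow> nat \<times> nat \<Rightarrow> real" where
  "entry_prod K x u v =
     signed_entry (fst u) (fst v) (fst (x (edge_block OnlyG K (fst u) (fst v)))) *
     signed_entry (snd v) (snd u) (snd (x (edge_block OnlyH K (snd v) (snd u))))"

lemma signed_entry_abs_le: "\<bar>signed_entry i j e\<bar> \<le> 1"
  by (simp add: signed_entry_def)

lemma signed_entry_same [simp]: "signed_entry i i e = 0"
  by (simp add: signed_entry_def)

lemma entry_prod_abs_le: "\<bar>entry_prod K x u v\<bar> \<le> 1"
  unfolding entry_prod_def abs_mult
  by (intro mult_le_one abs_ge_zero signed_entry_abs_le)

text \<open>\<open>mk\<close> stands for \<open>OnlyG\<close> or \<open>OnlyH\<close>. Sorting the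
  two indices makes a block remember exactly the unordered pair.\<close>

lemma edge_block_eq_iff:
  assumes "\<And>a b a' b'. mk a b = mk a' b' \<Longrightarrow> a = a' \<and> b = b'"
    and "\<And>a b a' b'. mk a b \<noteq> Common a' b'"
  shows "edge_block mk K i j = edge_block mk K k l \<longleftrightarrow>
    i = k \<and> j = l \<or> i = l \<and> j = k"
proof
  assume eq: "edge_block mk K i j = edge_block mk K k l"
  have "Suc (min i j) = Suc (min k l) \<and> Suc (max i j) = Suc (max k l)"
    using eq assms(1)[of "Suc (min i j)" "Suc (max i j)" "Suc (min k l)" "Suc (max k l)"]
      assms(2)[of "Suc (min i j)" "Suc (max i j)" "Suc (min k l)" "Suc (max k l)"]
      assms(2)[of "Suc (min k l)" "Suc (max k l)" "Suc (min i j)" "Suc (max i j)"]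
    by (auto simp: edge_block_def split: if_splits)
  then show "i = k \<and> j = l \<or> i = l \<and> j = k" by (auto simp: min_def max_def split: if_splits)
qed (auto simp: edge_block_def min.commute max.commute)

text \<open>Identifies the correlated terms: an entry of A and an entry of B can share a block only
  if it is a \<open>Common\<close> one, that is, the same edge inside the first K vertices.\<close>

lemma edge_blockG_eq_H:
  assumes "edge_block OnlyG K i j = edge_block OnlyH K k l"
  shows "i < K" "j < K" "i = k \<and> j = l \<or> i = l \<and> j = k"
  using assms by (auto simp: edge_block_def min_def max_def split: if_splits)

lemma edge_block_in_adj_blocks:
  assumes "i \<noteq> j" "K \<le> min m n"
  shows "i < m \<Longrightarrow> j < m \<Longrightarrow> edge_block OnlyG K i j \<in> adj_blocks m n K"
    and "i < n \<Longrightarrow> j < n \<Longrightarrow> edge_block OnlyH K i j \<in> adj_blocks m n K"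
  using assms by (auto simp: edge_block_def adj_blocks_def min_def max_def)

lemma finite_adj_blocks: "finite (adj_blocks m n K)"
proof -
  have "adj_blocks m n K \<subseteq> case_prod Common ` ({..K} \<times> {..K}) \<union>
      case_prod OnlyG ` ({..m} \<times> {..m}) \<union> case_prod OnlyH ` ({..n} \<times> {..n})"
  proof
    fix b assume b: "b \<in> adj_blocks m n K"
    show "b \<in> case_prod Common ` ({..K} \<times> {..K}) \<union>
      case_prod OnlyG ` ({..m} \<times> {..m}) \<union> case_prod OnlyH ` ({..n} \<times> {..n})"
    proof (cases b)
      case (Common i j)
      then have "(i, j) \<in> {..K} \<times> {..K}" using b by (auto simp: adj_blocks_def)
      then show ?thesis unfolding Common by (intro UnI1) (auto intro!: image_eqI[of _ _ "(i, j)"])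
    next
      case (OnlyG i j)
      then have "(i, j) \<in> {..m} \<times> {..m}" using b by (auto simp: adj_blocks_def)
      then show ?thesis unfolding OnlyG
        by (intro UnI1[OF UnI2]) (auto intro!: image_eqI[of _ _ "(i, j)"])
    next
      case (OnlyH i j)
      then have "(i, j) \<in> {..n} \<times> {..n}" using b by (auto simp: adj_blocks_def)
      then show ?thesis unfolding OnlyH by (intro UnI2) (auto intro!: image_eqI[of _ _ "(i, j)"])
    qed
  qed
  then show ?thesis by (rule finite_subset) simp
qed

text \<open>A block determines an unordered pair, which has two orderings, and injectivity of
  \<open>h\<close> (either \<open>fst\<close> or \<open>snd\<close>) recovers (u, v) from the
  ordered pair.\<close>

lemma card_edge_block_fiber_le:
  fixes h :: "nat \<times> nat \<Rightarrow> nat"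
  assumes mk: "\<And>a b a' b'. mk a b = mk a' b' \<Longrightarrow> a = a' \<and> b = b'"
    "\<And>a b a' b'. mk a b \<noteq> Common a' b'"
    and inj: "inj_on h S" "inj_on h S'"
  shows "card {(u, v) \<in> S \<times> S'. edge_block mk K (h u) (h v) = b} \<le> 2"
    and "finite {(u, v) \<in> S \<times> S'. edge_block mk K (h u) (h v) = b}"
proof -
  let ?F = "{(u, v) \<in> S \<times> S'. edge_block mk K (h u) (h v) = b}"
  have iff: "edge_block mk K i j = edge_block mk K k l \<longleftrightarrow> i = k \<and> j = l \<or> i = l \<and> j = k"
    for i j k l
  proof (rule edge_block_eq_iff)
    show "a = a' \<and> b = b'" if "mk a b = mk a' b'" for a b a' b' using that by (rule mk(1))
    show "mk a b \<noteq> Common a' b'" for a b a' b' by (rule mk(2))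
  qed
  have inj': "inj_on (map_prod h h) ?F"
    using inj by (auto simp: inj_on_def)
  have "\<exists>i j. map_prod h h ` ?F \<subseteq> {(i, j), (j, i)}"
  proof (cases "?F = {}")
    case True
    have "map_prod h h ` ?F \<subseteq> {(0, 0), (0, 0)}" unfolding True by simp
    then show ?thesis by blast
  next
    case False
    then obtain u v where uv: "edge_block mk K (h u) (h v) = b" by auto
    have "map_prod h h ` ?F \<subseteq> {(h u, h v), (h v, h u)}"
    proof
      fix e assume "e \<in> map_prod h h ` ?F"
      then obtain u' v' where e: "e = (h u', h v')" "edge_block mk K (h u') (h v') = b" by auto
      then have "edge_block mk K (h u') (h v') = edge_block mk K (h u) (h v)"
        using uv by simp
      then have "h u' = h u \<and> h v' = h v \<or> h u' = h v \<and> h v' = h u"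
        by (rule iff[THEN iffD1])
      then show "e \<in> {(h u, h v), (h v, h u)}"
        unfolding e(1) by auto
    qed
    then show ?thesis by blast
  qed
  then obtain i j where sub: "map_prod h h ` ?F \<subseteq> {(i, j), (j, i)}" by blast
  then have fin: "finite (map_prod h h ` ?F)" by (rule finite_subset) simp
  then show "finite ?F" using inj' by (rule finite_imageD)
  have "card ?F = card (map_prod h h ` ?F)" by (rule card_image[OF inj', symmetric])
  also have "\<dots> \<le> card {(i, j), (j, i)}" by (rule card_mono[OF _ sub]) simp
  also have "\<dots> \<le> 2" using card_length[of "[(i, j), (j, i)]"] by (simp del: distinct_card)
  finally show "card ?F \<le> 2" .
qed

text \<open>The blocks a summand really depends on. A term with a loop in either graph is
  identically 0 and gets the empty set; for such a term \<open>edge_block\<close> need not lie in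
  \<open>adj_blocks\<close>.\<close>

definition term_blocks :: "nat \<Rightarrow> (nat \<times> nat) \<times> (nat \<times> nat) \<Rightarrow> adj_block set" where
  "term_blocks K = (\<lambda>(u, v). if fst u = fst v \<or> snd u = snd v then {} else
     {edge_block OnlyG K (fst u) (fst v), edge_block OnlyH K (snd v) (snd u)})"

lemma entry_prod_dep:
  assumes "\<And>b. b \<in> term_blocks K (u, v) \<Longrightarrow> x b = y b"
  shows "entry_prod K x u v = entry_prod K y u v"
  using assms by (cases "fst u = fst v \<or> snd u = snd v") (auto simp: entry_prod_def term_blocks_def)

lemma card_term_blocks_le: "card (term_blocks K t) \<le> 2"
  by (cases t) (simp add: term_blocks_def card_insert_if)

lemma card_terms_with_block_le:
  assumes "inj_on fst S" "inj_on snd S" "inj_on fst S'" "inj_on snd S'"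
  shows "card {t \<in> S \<times> S'. b \<in> term_blocks K t} \<le> 4"
    and "finite {t \<in> S \<times> S'. b \<in> term_blocks K t}"
proof -
  let ?G = "{(u, v) \<in> S \<times> S'. edge_block OnlyG K (fst u) (fst v) = b}"
  \<comment> \<open>\<open>term_blocks\<close> lists the indices of B in the opposite order, which
    is harmless because \<open>edge_block\<close> is symmetric in them.\<close>
  let ?H = "{(u, v) \<in> S \<times> S'. edge_block OnlyH K (snd u) (snd v) = b}"
  have G: "card ?G \<le> 2" "finite ?G"
    by (rule card_edge_block_fiber_le, simp, simp, fact, fact)+
  have H: "card ?H \<le> 2" "finite ?H"
    by (rule card_edge_block_fiber_le, simp, simp, fact, fact)+
  have sub: "{t \<in> S \<times> S'. b \<in> term_blocks K t} \<subseteq> ?G \<union> ?H"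
    by (auto simp: term_blocks_def edge_block_def min.commute max.commute split: if_splits)
  then show "finite {t \<in> S \<times> S'. b \<in> term_blocks K t}"
    by (rule finite_subset) (use G H in simp)
  have "card {t \<in> S \<times> S'. b \<in> term_blocks K t} \<le> card (?G \<union> ?H)"
    using sub G H by (intro card_mono) simp_all
  also have "\<dots> \<le> card ?G + card ?H" by (rule card_Un_le)
  finally show "card {t \<in> S \<times> S'. b \<in> term_blocks K t} \<le> 4" using G H by simp
qed

subsection \<open>Expectations of products of entries\<close>

text \<open>A sign is twice an indicator minus 1, so the mean is (2P-1)^2 plus four times the
  covariance. Both variances are P(1-P), which is nonzero, so the covariance is r P(1-P).\<close>

lemma (in prob_space) expectation_signed_prod:
  assumes [measurable]: "{\<omega> \<in> space M. a \<omega>} \<in> sets M" "{\<omega> \<in> space M. b \<omega>} \<in> sets M"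
    and P: "prob {\<omega> \<in> space M. a \<omega>} = P" "prob {\<omega> \<in> space M. b \<omega>} = P" "0 < P" "P < 1"
    and r: "pearson_correlation (\<lambda>\<omega>. of_bool (a \<omega>)) (\<lambda>\<omega>. of_bool (b \<omega>)) = r"
  shows "expectation (\<lambda>\<omega>. (if a \<omega> then 1 else - 1) * (if b \<omega> then 1 else - 1 :: real)) =
    (2 * P - 1)\<^sup>2 + 4 * r * (P * (1 - P))"
proof -
  define A where "A = (\<lambda>\<omega>. of_bool (a \<omega>) :: real)"
  define B where "B = (\<lambda>\<omega>. of_bool (b \<omega>) :: real)"
  define C where "C = (\<lambda>\<omega>. of_bool (a \<omega> \<and> b \<omega>) :: real)"
  have int: "integrable M (\<lambda>\<omega>. of_bool (Q \<omega>) :: real)"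
      "expectation (\<lambda>\<omega>. of_bool (Q \<omega>) :: real) = prob {\<omega> \<in> space M. Q \<omega>}"
    if [measurable]: "{\<omega> \<in> space M. Q \<omega>} \<in> sets M" for Q
  proof -
    have "(\<lambda>\<omega>. of_bool (Q \<omega>) :: real) \<in> borel_measurable M \<longleftrightarrow>
        (indicator {\<omega> \<in> space M. Q \<omega>} :: 'a \<Rightarrow> real) \<in> borel_measurable M"
      by (intro measurable_cong) (simp add: indicator_def)
    then have "(\<lambda>\<omega>. of_bool (Q \<omega>) :: real) \<in> borel_measurable M" by simp
    then show "integrable M (\<lambda>\<omega>. of_bool (Q \<omega>) :: real)"
      by (intro integrable_const_bound[of _ 1]) auto
    have "expectation (\<lambda>\<omega>. of_bool (Q \<omega>) :: real) = expectation (indicator {\<omega> \<in> space M. Q \<omega>})"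
      by (intro Bochner_Integration.integral_cong) (simp_all add: indicator_def)
    then show "expectation (\<lambda>\<omega>. of_bool (Q \<omega>) :: real) = prob {\<omega> \<in> space M. Q \<omega>}" by simp
  qed
  have "{\<omega> \<in> space M. a \<omega> \<and> b \<omega>} = {\<omega> \<in> space M. a \<omega>} \<inter> {\<omega> \<in> space M. b \<omega>}" by auto
  then have [measurable]: "{\<omega> \<in> space M. a \<omega> \<and> b \<omega>} \<in> sets M" by simp
  have [simp]: "integrable M A" "integrable M B" "integrable M C"
    and E: "expectation A = P" "expectation B = P"
    unfolding A_def B_def C_def using P by (simp_all add: int)
  define e where "e = expectation C"
  have "covariance A B = expectation (\<lambda>\<omega>. C \<omega> - P * A \<omega> - P * B \<omega> + P\<^sup>2)"
    unfolding covariance_def E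
    by (intro Bochner_Integration.integral_cong)
       (auto simp: A_def B_def C_def algebra_simps power2_eq_square)
  also have "\<dots> = e - P\<^sup>2" by (simp add: E e_def prob_space power2_eq_square)
  finally have cov: "covariance A B = e - P\<^sup>2" .
  have "variance A = expectation (\<lambda>\<omega>. (1 - 2 * P) * A \<omega> + P\<^sup>2)"
    unfolding E
    by (intro Bochner_Integration.integral_cong) (auto simp: A_def algebra_simps power2_eq_square)
  also have "\<dots> = P * (1 - P)" by (simp add: E prob_space power2_eq_square algebra_simps)
  finally have varA: "variance A = P * (1 - P)" .
  have "variance B = expectation (\<lambda>\<omega>. (1 - 2 * P) * B \<omega> + P\<^sup>2)"
    unfolding E
    by (intro Bochner_Integration.integral_cong) (auto simp: B_def algebra_simps power2_eq_square)
  also have "\<dots> = P * (1 - P)" by (simp add: E prob_space power2_eq_square algebra_simps)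
  finally have varB: "variance B = P * (1 - P)" .
  have pos: "0 < P * (1 - P)" using P by simp
  have "r = (e - P\<^sup>2) / (P * (1 - P))"
    using r pos unfolding pearson_correlation_def A_def[symmetric] B_def[symmetric] cov varA varB
    by simp
  then have "r * (P * (1 - P)) = e - P\<^sup>2" using pos by (simp only: nonzero_eq_divide_eq)
  then have e: "e = P\<^sup>2 + r * (P * (1 - P))" by simp
  have "expectation (\<lambda>\<omega>. (if a \<omega> then 1 else - 1) * (if b \<omega> then 1 else - 1 :: real)) =
      expectation (\<lambda>\<omega>. 4 * C \<omega> - 2 * A \<omega> - 2 * B \<omega> + 1)"
    by (intro Bochner_Integration.integral_cong) (auto simp: A_def B_def C_def)
  also have "\<dots> = 4 * e - 4 * P + 1" by (simp add: E e_def prob_space)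
  also have "\<dots> = (2 * P - 1)\<^sup>2 + 4 * r * (P * (1 - P))"
    by (simp add: e power2_eq_square algebra_simps)
  finally show ?thesis .
qed

lemma (in prob_space) expectation_sign:
  assumes "{\<omega> \<in> space M. Q \<omega>} \<in> sets M"
  shows "expectation (\<lambda>\<omega>. if Q \<omega> then 1 else - 1 :: real) = 2 * prob {\<omega> \<in> space M. Q \<omega>} - 1"
proof -
  have "expectation (\<lambda>\<omega>. if Q \<omega> then 1 else - 1 :: real) =
      expectation (\<lambda>\<omega>. 2 * indicator {\<omega> \<in> space M. Q \<omega>} \<omega> - 1)"
    by (intro Bochner_Integration.integral_cong) (auto simp: indicator_def)
  also have "\<dots> = 2 * prob {\<omega> \<in> space M. Q \<omega>} - 1"
    using assms
    by (subst Bochner_Integration.integral_diff) (auto simp: prob_space emeasure_eq_measure)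
  finally show ?thesis .
qed

section \<open>Means of single terms in the correlated model\<close>

context correlated_bernoulli_graphs
begin

abbreviation blocks :: "'a \<Rightarrow> adj_block \<Rightarrow> bool \<times> bool" where
  "blocks \<omega> \<equiv> \<lambda>b. block_adjacency (G \<omega>) (H \<omega>) b"

lemma block_measurable:
  assumes "b \<in> adj_blocks m n K"
  shows "(\<lambda>\<omega>. blocks \<omega> b) \<in> measurable M (count_space UNIV)"
  using independence assms by (auto simp: indep_vars_def)

lemma block_event:
  assumes "b \<in> adj_blocks m n K"
  shows "{\<omega> \<in> space M. Q (blocks \<omega> b)} \<in> sets M"
proof -
  have "{\<omega> \<in> space M. Q (blocks \<omega> b)} = (\<lambda>\<omega>. blocks \<omega> b) -` {x. Q x} \<inter> space M" by auto
  also have "\<dots> \<in> sets M" using block_measurable[OF assms] by (rule measurable_sets) simp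
  finally show ?thesis .
qed

lemma integrable_block:
  fixes \<phi> :: "bool \<times> bool \<Rightarrow> real"
  assumes "b \<in> adj_blocks m n K"
  shows "integrable M (\<lambda>\<omega>. \<phi> (blocks \<omega> b))"
proof (rule integrable_const_bound)
  show "AE \<omega> in M. norm (\<phi> (blocks \<omega> b)) \<le> Max (range (\<lambda>x. \<bar>\<phi> x\<bar>))"
    by (intro AE_I2) simp
  show "(\<lambda>\<omega>. \<phi> (blocks \<omega> b)) \<in> borel_measurable M"
    using block_measurable[OF assms] by (rule measurable_compose) simp
qed

lemma expectation_distinct_blocks:
  fixes \<phi> \<psi> :: "bool \<times> bool \<Rightarrow> real"
  assumes b: "b \<in> adj_blocks m n K" "b' \<in> adj_blocks m n K" "b \<noteq> b'"
  shows "expectation (\<lambda>\<omega>. \<phi> (blocks \<omega> b) * \<psi> (blocks \<omega> b')) =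
    expectation (\<lambda>\<omega>. \<phi> (blocks \<omega> b)) * expectation (\<lambda>\<omega>. \<psi> (blocks \<omega> b'))"
proof -
  define Y where "Y i = (if i = b then \<phi> else \<psi>)" for i
  have "indep_vars (\<lambda>_. count_space UNIV) (\<lambda>b \<omega>. blocks \<omega> b) {b, b'}"
    using independence by (rule indep_vars_subset) (use b in auto)
  then have ind: "indep_vars (\<lambda>_. borel) (\<lambda>i \<omega>. Y i (blocks \<omega> i)) {b, b'}"
    by (rule indep_vars_compose2) simp
  have "expectation (\<lambda>\<omega>. \<Prod>i\<in>{b, b'}. Y i (blocks \<omega> i)) =
      (\<Prod>i\<in>{b, b'}. expectation (\<lambda>\<omega>. Y i (blocks \<omega> i)))"
    using ind by (rule indep_vars_lebesgue_integral[rotated]) (use b integrable_block in auto)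
  then show ?thesis using b by (simp add: Y_def)
qed

lemma fst_edge_block:
  "fst (blocks \<omega> (edge_block OnlyG K i j)) \<longleftrightarrow> (Suc (min i j), Suc (max i j)) \<in> parcs (G \<omega>)"
  by (simp add: edge_block_def)

lemma snd_edge_block:
  "snd (blocks \<omega> (edge_block OnlyH K i j)) \<longleftrightarrow> (Suc (min i j), Suc (max i j)) \<in> parcs (H \<omega>)"
  by (simp add: edge_block_def)

text \<open>Blocks store each edge only with its smaller endpoint first; symmetry of the arc sets
  covers the other orientation.\<close>

lemma signed_adj_mat_entry_prod:
  assumes \<omega>: "\<omega> \<in> space M" and u: "u \<in> {..<m} \<times> {..<n}" and v: "v \<in> {..<m} \<times> {..<n}"
  shows "signed_adj_mat m (G \<omega>) $$ (fst u, fst v) * signed_adj_mat n (H \<omega>) $$ (snd v, snd u) =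
    entry_prod K (blocks \<omega>) u v"
proof -
  interpret G: pair_graph "G \<omega>" using G_graph[OF \<omega>] by simp
  interpret H: pair_graph "H \<omega>" using H_graph[OF \<omega>] by simp
  have "(i, j) \<in> parcs (G \<omega>) \<longleftrightarrow> (min i j, max i j) \<in> parcs (G \<omega>)"
    "(i, j) \<in> parcs (H \<omega>) \<longleftrightarrow> (min i j, max i j) \<in> parcs (H \<omega>)" for i j
    using G.arcs_symmetric H.arcs_symmetric by (auto simp: min_def max_def)
  note sym = this[of "Suc _" "Suc _"]
  have "i < m \<Longrightarrow> j < m \<Longrightarrow> signed_adj_mat m (G \<omega>) $$ (i, j) =
      signed_entry i j (fst (blocks \<omega> (edge_block OnlyG K i j)))" for i j
    unfolding fst_edge_block using sym(1)[of i j] by (simp add: signed_adj_mat_def signed_entry_def)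
  moreover have "i < n \<Longrightarrow> j < n \<Longrightarrow> signed_adj_mat n (H \<omega>) $$ (i, j) =
      signed_entry i j (snd (blocks \<omega> (edge_block OnlyH K i j)))" for i j
    unfolding snd_edge_block using sym(2)[of i j] by (simp add: signed_adj_mat_def signed_entry_def)
  ultimately show ?thesis using u v by (auto simp: entry_prod_def)
qed

lemma expectation_entry:
  assumes "i \<noteq> j"
  shows "i < m \<Longrightarrow> j < m \<Longrightarrow>
      expectation (\<lambda>\<omega>. signed_entry i j (fst (blocks \<omega> (edge_block OnlyG K i j)))) =
      2 * p (Suc (min i j)) (Suc (max i j)) - 1"
    and "i < n \<Longrightarrow> j < n \<Longrightarrow>
      expectation (\<lambda>\<omega>. signed_entry i j (snd (blocks \<omega> (edge_block OnlyH K i j)))) =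
      2 * p (Suc (min i j)) (Suc (max i j)) - 1"
proof -
  note inB = edge_block_in_adj_blocks[OF assms K_le]
  have less: "min i j < max i j" using assms by (auto simp: min_def max_def)
  show "expectation (\<lambda>\<omega>. signed_entry i j (fst (blocks \<omega> (edge_block OnlyG K i j)))) =
      2 * p (Suc (min i j)) (Suc (max i j)) - 1" if "i < m" "j < m"
    using expectation_sign[OF block_event[OF inB(1)[OF that], of fst]]
      G_prob[of "Suc (min i j)" "Suc (max i j)"] less that assms
    by (simp add: signed_entry_def fst_edge_block)
  show "expectation (\<lambda>\<omega>. signed_entry i j (snd (blocks \<omega> (edge_block OnlyH K i j)))) =
      2 * p (Suc (min i j)) (Suc (max i j)) - 1" if "i < n" "j < n"
    using expectation_sign[OF block_event[OF inB(2)[OF that], of snd]]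
      H_prob[of "Suc (min i j)" "Suc (max i j)"] less that assms
    by (simp add: signed_entry_def snd_edge_block)
qed

text \<open>Off the diagonal square the two entries come from the same edge only if \<open>v\<close>
  is the swap of \<open>u\<close>, where just the trivial bound 1 is used. Loops give 0. All other
  terms involve two distinct, hence independent, blocks, whose entry means have absolute value at
  most 1 - 2q.\<close>

lemma expectation_entry_prod_le:
  assumes q: "\<And>i j. 1 \<le> i \<Longrightarrow> i < j \<Longrightarrow> j \<le> max m n \<Longrightarrow> p i j \<in> {q..1 - q}"
    and u: "u \<in> {..<m} \<times> {..<n}" and v: "v \<in> {..<m} \<times> {..<n}"
    and nd: "(u, v) \<notin> diagonal K \<times> diagonal K"
  shows "expectation (\<lambda>\<omega>. entry_prod K (blocks \<omega>) u v) \<le> (1 - 2 * q)\<^sup>2 + of_bool (v = prod.swap u)"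
proof -
  obtain i j k l where uv: "u = (i, k)" "v = (j, l)" "i < m" "j < m" "k < n" "l < n"
    using u v by (cases u; cases v) auto
  consider "i = j \<or> k = l" | "i \<noteq> j" "k \<noteq> l" "v = prod.swap u" | "i \<noteq> j" "k \<noteq> l" "v \<noteq> prod.swap u"
    by blast
  then show ?thesis
  proof cases
    case 1
    then have "entry_prod K (blocks \<omega>) u v = 0" for \<omega> by (auto simp: entry_prod_def uv)
    then show ?thesis by simp
  next
    case 2
    have "expectation (\<lambda>\<omega>. entry_prod K (blocks \<omega>) u v) \<le> 1"
    \<comment> \<open>A non-integrable function has integral 0 by convention, so the bound 1 holds
      in that case too.\<close>
    proof (cases "integrable M (\<lambda>\<omega>. entry_prod K (blocks \<omega>) u v)")
      case True
      have "expectation (\<lambda>\<omega>. entry_prod K (blocks \<omega>) u v) \<le> expectation (\<lambda>\<omega>. 1)"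
        using True entry_prod_abs_le[of K "blocks \<omega>" u v for \<omega>]
        by (intro integral_mono) (auto simp: abs_le_iff)
      then show ?thesis by (simp add: prob_space)
    qed (simp add: not_integrable_integral_eq)
    also have "\<dots> \<le> (1 - 2 * q)\<^sup>2 + of_bool (v = prod.swap u)"
      using 2 by simp
    finally show ?thesis .
  next
    case 3
    let ?b = "edge_block OnlyG K i j" and ?b' = "edge_block OnlyH K l k"
    have ne: "?b \<noteq> ?b'"
    proof
      assume eq: "?b = ?b'"
      have "i < K" "j < K" "i = l \<and> j = k \<or> i = k \<and> j = l"
        using edge_blockG_eq_H[OF eq] by auto
      then show False using 3 nd by (auto simp: uv diagonal_def)
    qed
    have inB: "?b \<in> adj_blocks m n K" "?b' \<in> adj_blocks m n K"
      using edge_block_in_adj_blocks[OF 3(1) K_le] edge_block_in_adj_blocks[OF _ K_le, of l k] uv 3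
      by auto
    have "expectation (\<lambda>\<omega>. entry_prod K (blocks \<omega>) u v) =
        expectation (\<lambda>\<omega>. signed_entry i j (fst (blocks \<omega> ?b))) *
        expectation (\<lambda>\<omega>. signed_entry l k (snd (blocks \<omega> ?b')))"
      unfolding entry_prod_def uv fst_conv snd_conv
      by (rule expectation_distinct_blocks[OF inB ne, of "\<lambda>x. signed_entry i j (fst x)"
            "\<lambda>x. signed_entry l k (snd x)"])
    also have "\<dots> = (2 * p (Suc (min i j)) (Suc (max i j)) - 1) *
        (2 * p (Suc (min l k)) (Suc (max l k)) - 1)"
      using expectation_entry(1)[of i j] expectation_entry(2)[of l k] uv 3 by simp
    also have "\<dots> \<le> \<bar>2 * p (Suc (min i j)) (Suc (max i j)) - 1\<bar> *
        \<bar>2 * p (Suc (min l k)) (Suc (max l k)) - 1\<bar>"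
      by (simp add: abs_mult[symmetric])
    also have "\<dots> \<le> (1 - 2 * q) * (1 - 2 * q)"
    proof -
      have ij: "Suc (min i j) < Suc (max i j)" "Suc (min l k) < Suc (max l k)"
        "Suc (max i j) \<le> max m n" "Suc (max l k) \<le> max m n"
        using 3 uv by auto
      have "\<bar>2 * p (Suc (min i j)) (Suc (max i j)) - 1\<bar> \<le> 1 - 2 * q"
        "\<bar>2 * p (Suc (min l k)) (Suc (max l k)) - 1\<bar> \<le> 1 - 2 * q"
        using q[OF _ ij(1,3)] q[OF _ ij(2,4)] by (simp_all add: abs_le_iff)
      then show ?thesis by (intro mult_mono) auto
    qed
    finally show ?thesis using 3(3) by (simp add: power2_eq_square)
  qed
qed

text \<open>As 4p(1-p) = 1 - (2p-1)^2, the mean is \<rho> + (1-\<rho>)(2p-1)^2. Positivity of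
  \<open>q\<close> keeps p strictly between 0 and 1, so that the correlation determines the
  covariance.\<close>

lemma expectation_entry_prod_diagonal_ge:
  assumes q: "0 < q" "\<And>i j. 1 \<le> i \<Longrightarrow> i < j \<Longrightarrow> j \<le> max m n \<Longrightarrow> p i j \<in> {q..1 - q}"
    and ij: "i < K" "j < K" "i \<noteq> j"
  shows "\<rho> (Suc (min i j)) (Suc (max i j)) \<le> expectation (\<lambda>\<omega>. entry_prod K (blocks \<omega>) (i, i) (j, j))"
proof -
  define a b where "a = Suc (min i j)" and "b = Suc (max i j)"
  have ab: "1 \<le> a" "a < b" "b \<le> K" "b \<le> m" "b \<le> n" "b \<le> max m n"
    using ij K_le by (auto simp: a_def b_def)
  have P: "0 < p a b" "p a b < 1" using q(1) q(2)[OF ab(1,2,6)] by auto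
  have C: "Common a b \<in> adj_blocks m n K" using ab by (auto simp: adj_blocks_def)
  have "expectation (\<lambda>\<omega>. entry_prod K (blocks \<omega>) (i, i) (j, j)) =
      expectation (\<lambda>\<omega>. (if (a, b) \<in> parcs (G \<omega>) then 1 else - 1) *
        (if (a, b) \<in> parcs (H \<omega>) then 1 else - 1 :: real))"
    using ij by (intro Bochner_Integration.integral_cong)
      (auto simp: entry_prod_def fst_edge_block snd_edge_block a_def b_def signed_entry_def
         min.commute max.commute)
  also have "\<dots> = (2 * p a b - 1)\<^sup>2 + 4 * \<rho> a b * (p a b * (1 - p a b))"
    using block_event[OF C, of fst] block_event[OF C, of snd] ab P
    by (intro expectation_signed_prod) (simp_all add: G_prob H_prob correlation)
  also have "\<dots> = \<rho> a b + (1 - \<rho> a b) * (2 * p a b - 1)\<^sup>2"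
    by (simp add: power2_eq_square algebra_simps)
  also have "\<dots> \<ge> \<rho> a b" using \<rho>_range[OF ab(1-3)] by simp
  finally show ?thesis unfolding a_def b_def .
qed

end

subsection \<open>Concentration and union bound\<close>

text \<open>K^2 - (K-a)(K-b) = K(a+b) - ab, where a and b are the sizes of A - C and B - D. The
  value depends on these sizes only, so the terms gained and the terms lost are equally
  many.\<close>

lemma card_Times_Diff:
  assumes "finite A" "finite B" "finite C" "finite D" "card A = K" "card B = K"
  shows "real (card (A \<times> B - C \<times> D)) =
    real K * (real (card (A - C)) + real (card (B - D))) - real (card (A - C)) * real (card (B - D))"
proof -
  have A: "real K = card (A \<inter> C) + card (A - C)" and B: "real K = card (B \<inter> D) + card (B - D)"
    using assms card_Int_Diff[of A C] card_Int_Diff[of B D] by auto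
  have "card (A \<times> B) = card (A \<times> B \<inter> C \<times> D) + card (A \<times> B - C \<times> D)"
    using assms by (intro card_Int_Diff) auto
  also have "A \<times> B \<inter> C \<times> D = (A \<inter> C) \<times> (B \<inter> D)" by auto
  finally have "real (card (A \<times> B)) =
      real (card (A \<inter> C)) * real (card (B \<inter> D)) + real (card (A \<times> B - C \<times> D))"
    by (simp add: card_cartesian_product flip: of_nat_mult of_nat_add)
  then have eq: "real K * real K =
      real (card (A \<inter> C)) * real (card (B \<inter> D)) + real (card (A \<times> B - C \<times> D))"
    using assms by (simp add: card_cartesian_product)
  have A': "real (card (A \<inter> C)) = real K - card (A - C)"
    and B': "real (card (B \<inter> D)) = real K - card (B - D)" using A B by linarith+
  show ?thesis using eq unfolding A' B' by (simp add: algebra_simps)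
qed

lemma card_Diff_eq_card_Diff:
  assumes "finite A" "finite B" "card A = card B"
  shows "card (A - B) = card (B - A)"
  using assms card_Int_Diff[of A B] card_Int_Diff[of B A] by (simp add: Int_commute)

lemma displaced_pair_pos:
  assumes "S \<in> partial_matchings m n K" "S' \<in> partial_matchings m n K"
    and ne: "(S, S') \<noteq> (diagonal K, diagonal K)"
  shows "0 < card (S - diagonal K) + card (S' - diagonal K)"
proof (rule ccontr)
  assume *: "\<not> ?thesis"
  have fin: "finite (diagonal K)" by (simp add: diagonal_def)
  have "S \<subseteq> diagonal K" "S' \<subseteq> diagonal K"
    using * finite_partial_matching[OF assms(1)] finite_partial_matching[OF assms(2)] by auto
  moreover have "card S = card (diagonal K)" "card S' = card (diagonal K)"
    using assms(1,2) by (auto simp: partial_matchings_def)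
  ultimately have "S = diagonal K" "S' = diagonal K"
    using card_subset_eq[OF fin] by blast+
  then show False using ne by simp
qed

context correlated_bernoulli_graphs
begin

text \<open>The L terms lost exceed the L terms gained by \<epsilon> each in mean, except that at
  most k1 swaps and k1 + k2 loops escape this comparison, which costs at most 2k in total. The
  hypothesis \<open>8 \<le> \<epsilon> * K\<close> makes 2k at most L \<epsilon> / 2.\<close>

lemma matching_pair_tail:
  fixes q \<epsilon> :: real
  assumes q: "0 < q" "\<And>i j. 1 \<le> i \<Longrightarrow> i < j \<Longrightarrow> j \<le> max m n \<Longrightarrow> p i j \<in> {q..1 - q}"
    and \<rho>_ge: "\<And>i j. 1 \<le> i \<Longrightarrow> i < j \<Longrightarrow> j \<le> K \<Longrightarrow> (1 - 2 * q)\<^sup>2 + \<epsilon> \<le> \<rho> i j"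
    and \<epsilon>: "0 < \<epsilon>" "8 \<le> \<epsilon> * K" and K2: "2 \<le> K"
    and S: "S \<in> partial_matchings m n K" and S': "S' \<in> partial_matchings m n K"
    and ne: "(S, S') \<noteq> (diagonal K, diagonal K)"
  defines "val \<equiv> \<lambda>S S' \<omega>. overlap (signed_adj_mat m (G \<omega>)) (signed_adj_mat n (H \<omega>)) S S'"
    and "k \<equiv> card (S - diagonal K) + card (S' - diagonal K)"
  shows "{\<omega> \<in> space M. val (diagonal K) (diagonal K) \<omega> \<le> val S S' \<omega>} \<in> sets M" (is ?meas)
    and "prob {\<omega> \<in> space M. val (diagonal K) (diagonal K) \<omega> \<le> val S S' \<omega>}
      \<le> exp (- (\<epsilon>\<^sup>2 * K * k / 512))" (is ?tail)
proof -
  let ?D = "diagonal K"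
  let ?J = "{..<m} \<times> {..<n}"
  have D: "?D \<in> partial_matchings m n K" using K_le by (intro diagonal_in_partial_matchings) auto
  have fin: "finite S" "finite S'" "finite ?D"
    using S S' D by (auto intro: finite_partial_matching)
  have card: "card S = K" "card S' = K" "card ?D = K"
    using S S' by (auto simp: partial_matchings_def)
  have sub: "S \<subseteq> ?J" "S' \<subseteq> ?J" "?D \<subseteq> ?J"
    using S S' D by (auto simp: partial_matchings_def)
  define T1 where "T1 = S \<times> S' - ?D \<times> ?D"
  define T2 where "T2 = ?D \<times> ?D - S \<times> S'"
  define T where "T = T1 \<union> T2"
  define h where "h x t = entry_prod K x (fst t) (snd t)" for x and t :: "(nat \<times> nat) \<times> (nat \<times> nat)"
  define g where "g t x = (if t \<in> ?D \<times> ?D then - 1 else 1) * h x t" for x t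
  have finT: "finite T1" "finite T2" "finite T" "T1 \<inter> T2 = {}"
    using fin by (auto simp: T1_def T2_def T_def)
  have T_sub: "T \<subseteq> ?J \<times> ?J" using sub by (auto simp: T_def T1_def T2_def)
  have sum_g: "(\<Sum>t\<in>T. g t x) = (\<Sum>t\<in>T1. h x t) - (\<Sum>t\<in>T2. h x t)" for x
  proof -
    have "(\<Sum>t\<in>T. g t x) = (\<Sum>t\<in>T1. g t x) + (\<Sum>t\<in>T2. g t x)"
      unfolding T_def using finT by (intro sum.union_disjoint) auto
    moreover have "(\<Sum>t\<in>T1. g t x) = (\<Sum>t\<in>T1. h x t)"
      by (intro sum.cong) (auto simp: T1_def g_def)
    moreover have "(\<Sum>t\<in>T2. g t x) = (\<Sum>t\<in>T2. - h x t)"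
      by (intro sum.cong) (auto simp: T2_def g_def)
    ultimately show ?thesis by (simp add: sum_negf)
  qed
  have val_eq: "val A B \<omega> = (\<Sum>t\<in>A \<times> B. h (blocks \<omega>) t)"
    if "\<omega> \<in> space M" "A \<subseteq> ?J" "B \<subseteq> ?J" for A B \<omega>
    unfolding val_def overlap_def sum.cartesian_product' h_def fst_conv snd_conv
    using that by (intro sum.cong refl signed_adj_mat_entry_prod) auto
  have diff: "(\<Sum>t\<in>T. g t (blocks \<omega>)) = val S S' \<omega> - val ?D ?D \<omega>" if "\<omega> \<in> space M" for \<omega>
  proof -
    have "(\<Sum>t\<in>S \<times> S'. h (blocks \<omega>) t) =
        (\<Sum>t\<in>S \<times> S' \<inter> ?D \<times> ?D. h (blocks \<omega>) t) + (\<Sum>t\<in>T1. h (blocks \<omega>) t)"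
      unfolding T1_def by (rule sum.Int_Diff) (use fin in simp)
    moreover have "(\<Sum>t\<in>?D \<times> ?D. h (blocks \<omega>) t) =
        (\<Sum>t\<in>?D \<times> ?D \<inter> S \<times> S'. h (blocks \<omega>) t) + (\<Sum>t\<in>T2. h (blocks \<omega>) t)"
      unfolding T2_def by (rule sum.Int_Diff) (use fin in simp)
    ultimately show ?thesis
      using val_eq[OF that sub(1,2)] val_eq[OF that sub(3,3)] by (simp add: sum_g Int_commute)
  qed
  have event: "{\<omega> \<in> space M. val ?D ?D \<omega> \<le> val S S' \<omega>} =
      {\<omega> \<in> space M. 0 \<le> (\<Sum>t\<in>T. g t (blocks \<omega>))}"
    using diff by auto
  define k1 k2 where "k1 = real (card (S - ?D))" and "k2 = real (card (S' - ?D))"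
  have kk: "real k = k1 + k2" by (simp add: k_def k1_def k2_def)
  have k_le: "k1 \<le> K" "k2 \<le> K" "0 \<le> k1" "0 \<le> k2"
    using card_mono[of S "S - ?D"] card_mono[of S' "S' - ?D"] fin card by (auto simp: k1_def k2_def)
  have kD: "real (card (?D - S)) = k1" "real (card (?D - S')) = k2"
    using card_Diff_eq_card_Diff[of ?D S] card_Diff_eq_card_Diff[of ?D S'] fin card
    by (simp_all add: k1_def k2_def)
  define L where "L = K * (k1 + k2) - k1 * k2"
  have L: "real (card T1) = L" "real (card T2) = L"
    unfolding T1_def T2_def L_def
    using fin card kD by (simp_all add: card_Times_Diff[where K = K] k1_def k2_def)
  \<comment> \<open>k1 k2 is at most K times the smaller of k1 and k2, hence at most half of K (k1 +
    k2).\<close>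
  have L_ge: "K * (k1 + k2) / 2 \<le> L"
  proof -
    have "k1 * k2 \<le> K * k2" "k1 * k2 \<le> K * k1"
      using mult_right_mono[OF k_le(1,4)] mult_right_mono[OF k_le(2,3)] by (simp_all add: mult.commute)
    moreover have "(a + b) / 2 \<le> a + b - x" if "x \<le> b" "x \<le> a" for a b x :: real
      using that by (simp add: field_simps)
    ultimately show ?thesis unfolding L_def distrib_left by blast
  qed
  have k_pos: "0 < k1 + k2"
    using displaced_pair_pos[OF S S' ne] by (simp add: k1_def k2_def flip: of_nat_add)
  have L_pos: "0 < L"
  proof -
    have "0 < K * (k1 + k2) / 2" using K2 k_pos by simp
    then show ?thesis using L_ge by linarith
  qed
  have h_int: "integrable M (\<lambda>\<omega>. h (blocks \<omega>) t)" if t: "t \<in> ?J \<times> ?J" for t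
  proof (cases "fst (fst t) = fst (snd t) \<or> snd (fst t) = snd (snd t)")
    case True
    then have "h (blocks \<omega>) t = 0" for \<omega> by (auto simp: h_def entry_prod_def)
    then show ?thesis by simp
  next
    case False
    have "(\<lambda>\<omega>. h (blocks \<omega>) t) \<in> borel_measurable M"
      unfolding h_def entry_prod_def
      using edge_block_in_adj_blocks[OF _ K_le, of "fst (fst t)" "fst (snd t)"]
        edge_block_in_adj_blocks[OF _ K_le, of "snd (snd t)" "snd (fst t)"] t False
      by (intro borel_measurable_times borel_measurable_integrable
          integrable_block[of _ "\<lambda>x. signed_entry _ _ (fst x)"]
          integrable_block[of _ "\<lambda>x. signed_entry _ _ (snd x)"]) auto
    then show ?thesis
      by (rule integrable_const_bound[of _ 1, rotated]) (simp add: h_def entry_prod_abs_le)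
  qed
  have E1: "(\<Sum>t\<in>T1. expectation (\<lambda>\<omega>. h (blocks \<omega>) t)) \<le> L * (1 - 2 * q)\<^sup>2 + k1"
  proof -
    have "(\<Sum>t\<in>T1. expectation (\<lambda>\<omega>. h (blocks \<omega>) t)) \<le>
        (\<Sum>t\<in>T1. (1 - 2 * q)\<^sup>2 + of_bool (snd t = prod.swap (fst t)))"
      unfolding h_def
      by (intro sum_mono expectation_entry_prod_le[OF q(2)]) (use sub in \<open>auto simp: T1_def\<close>)
    also have "\<dots> = L * (1 - 2 * q)\<^sup>2 + card {t \<in> T1. snd t = prod.swap (fst t)}"
      using finT L by (simp add: sum.distrib Int_def)
    \<comment> \<open>A diagonal \<open>u\<close> equals its swap, which would put (u, v) into the
      diagonal square excluded from \<open>T1\<close>; so the swaps are indexed by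
      \<open>S - ?D\<close>.\<close>
    also have "card {t \<in> T1. snd t = prod.swap (fst t)} \<le> card ((\<lambda>u. (u, prod.swap u)) ` (S - ?D))"
      using fin by (intro card_mono) (auto simp: T1_def diagonal_def)
    also have "\<dots> \<le> card (S - ?D)" using fin by (intro card_image_le) auto
    finally show ?thesis by (simp add: k1_def)
  qed
  \<comment> \<open>Needed for loops: their mean 0 is at least (1-2q)^2 + \<epsilon> - 1. The edge
    (1, 2) exists since K is at least 2.\<close>
  have t\<epsilon>: "(1 - 2 * q)\<^sup>2 + \<epsilon> \<le> 1" using \<rho>_ge[of 1 2] \<rho>_range[of 1 2] K2 by auto
  have E2: "L * ((1 - 2 * q)\<^sup>2 + \<epsilon>) - (k1 + k2) \<le> (\<Sum>t\<in>T2. expectation (\<lambda>\<omega>. h (blocks \<omega>) t))"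
  proof -
    have "real (card {t \<in> T2. fst t = snd t}) \<le> k1 + k2"
    proof -
      \<comment> \<open>A loop (u, u) survives in \<open>T2\<close> only if \<open>u\<close> is
        missing from \<open>S\<close> or from \<open>S'\<close>.\<close>
      have "card {t \<in> T2. fst t = snd t} \<le> card ((\<lambda>u. (u, u)) ` ((?D - S) \<union> (?D - S')))"
        using fin by (intro card_mono) (auto simp: T2_def)
      also have "\<dots> \<le> card ((?D - S) \<union> (?D - S'))" using fin by (intro card_image_le) auto
      also have "\<dots> \<le> card (?D - S) + card (?D - S')" by (rule card_Un_le)
      finally show ?thesis using kD by linarith
    qed
    then have "L * ((1 - 2 * q)\<^sup>2 + \<epsilon>) - (k1 + k2) \<le>
        L * ((1 - 2 * q)\<^sup>2 + \<epsilon>) - card {t \<in> T2. fst t = snd t}" by simp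
    also have "\<dots> = (\<Sum>t\<in>T2. (1 - 2 * q)\<^sup>2 + \<epsilon> - of_bool (fst t = snd t))"
      using finT L by (simp add: sum_subtractf Int_def)
    also have "\<dots> \<le> (\<Sum>t\<in>T2. expectation (\<lambda>\<omega>. h (blocks \<omega>) t))"
    proof (rule sum_mono)
      fix t assume "t \<in> T2"
      then obtain i j where t: "t = ((i, i), (j, j))" "i < K" "j < K"
        by (auto simp: T2_def diagonal_def)
      show "(1 - 2 * q)\<^sup>2 + \<epsilon> - of_bool (fst t = snd t) \<le> expectation (\<lambda>\<omega>. h (blocks \<omega>) t)"
      proof (cases "i = j")
        case True
        then have "h (blocks \<omega>) t = 0" for \<omega> by (simp add: t h_def entry_prod_def)
        then show ?thesis using True t\<epsilon> by (simp add: t)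
      next
        case False
        have "(1 - 2 * q)\<^sup>2 + \<epsilon> \<le> \<rho> (Suc (min i j)) (Suc (max i j))"
          using False t by (intro \<rho>_ge) auto
        also have "\<dots> \<le> expectation (\<lambda>\<omega>. h (blocks \<omega>) t)"
          unfolding h_def t fst_conv snd_conv
          by (rule expectation_entry_prod_diagonal_ge[OF q t(2,3) False])
        finally show ?thesis using False by (simp add: t)
      qed
    qed
    finally show ?thesis .
  qed
  have mean: "expectation (\<lambda>\<omega>. \<Sum>t\<in>T. g t (blocks \<omega>)) \<le> - (L * \<epsilon> / 2)"
  proof -
    have int1: "integrable M (\<lambda>\<omega>. h (blocks \<omega>) t)" if "t \<in> T1 \<union> T2" for t
      using h_int T_sub that by (auto simp: T_def)
    have "expectation (\<lambda>\<omega>. \<Sum>t\<in>T. g t (blocks \<omega>)) =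
        expectation (\<lambda>\<omega>. \<Sum>t\<in>T1. h (blocks \<omega>) t) - expectation (\<lambda>\<omega>. \<Sum>t\<in>T2. h (blocks \<omega>) t)"
      unfolding sum_g using int1
      by (intro Bochner_Integration.integral_diff Bochner_Integration.integrable_sum) auto
    also have "\<dots> = (\<Sum>t\<in>T1. expectation (\<lambda>\<omega>. h (blocks \<omega>) t)) -
        (\<Sum>t\<in>T2. expectation (\<lambda>\<omega>. h (blocks \<omega>) t))"
      using int1 by (intro arg_cong2[of _ _ _ _ minus] Bochner_Integration.integral_sum) auto
    also have "\<dots> \<le> (L * (1 - 2 * q)\<^sup>2 + k1) - (L * ((1 - 2 * q)\<^sup>2 + \<epsilon>) - (k1 + k2))"
      using E1 E2 by linarith
    also have "\<dots> \<le> 2 * (k1 + k2) - L * \<epsilon>"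
      using k_le by (simp add: algebra_simps)
    also have "2 * (k1 + k2) \<le> L * \<epsilon> / 2"
    proof -
      have "8 * (k1 + k2) \<le> \<epsilon> * K * (k1 + k2)"
        using \<epsilon>(2) k_pos by (intro mult_right_mono) auto
      also have "\<dots> = 2 * (\<epsilon> * (K * (k1 + k2) / 2))" by simp
      also have "\<dots> \<le> 2 * (\<epsilon> * L)" using L_ge \<epsilon>(1) by (intro mult_left_mono) auto
      finally show ?thesis by (simp add: mult.commute)
    qed
    finally show ?thesis by simp
  qed
  have g_dep: "g t x = g t y" if "t \<in> T" "\<And>b. b \<in> term_blocks K t \<Longrightarrow> x b = y b" for t x y
    using entry_prod_dep[of K "fst t" "snd t" x y] that(2) by (simp add: g_def h_def)
  have g_bound: "\<bar>g t x\<bar> \<le> 1" for t x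
    using entry_prod_abs_le[of K x "fst t" "snd t"] by (simp add: g_def h_def)
  have dep: "term_blocks K t \<subseteq> adj_blocks m n K" if "t \<in> T" for t
  proof -
    have "t \<in> ?J \<times> ?J" using T_sub that by blast
    then obtain a b c d where t: "t = ((a, b), (c, d))" "a < m" "c < m" "b < n" "d < n" by auto
    show ?thesis
      using edge_block_in_adj_blocks(1)[OF _ K_le, of a c]
        edge_block_in_adj_blocks(2)[OF _ K_le, of d b] t by (auto simp: term_blocks_def)
  qed
  \<comment> \<open>At most four terms of S x S' and four of the diagonal square read a given
    block.\<close>
  have deg: "card {t \<in> T. b \<in> term_blocks K t} \<le> 8" for b
  proof -
    have inj: "inj_on fst S" "inj_on snd S" "inj_on fst S'" "inj_on snd S'"
      "inj_on fst ?D" "inj_on snd ?D"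
      using S S' D by (auto simp: partial_matchings_def)
    note c1 = card_terms_with_block_le[OF inj(1-4), of b K]
    note c2 = card_terms_with_block_le[OF inj(5,6,5,6), of b K]
    have "card {t \<in> T. b \<in> term_blocks K t} \<le>
        card ({t \<in> S \<times> S'. b \<in> term_blocks K t} \<union> {t \<in> ?D \<times> ?D. b \<in> term_blocks K t})"
      using c1 c2 by (intro card_mono) (auto simp: T_def T1_def T2_def)
    also have "\<dots> \<le> card {t \<in> S \<times> S'. b \<in> term_blocks K t} +
        card {t \<in> ?D \<times> ?D. b \<in> term_blocks K t}"
      by (rule card_Un_le)
    finally show ?thesis using c1 c2 by linarith
  qed
  have cT: "real (card T) = 2 * L"
    unfolding T_def using finT L by (simp add: card_Un_disjoint)
  have "T \<noteq> {}" using cT L_pos by auto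
  note tail = bounded_differences_sum_tail[of "adj_blocks m n K" T "\<lambda>b \<omega>. blocks \<omega> b" g "term_blocks K" 8,
      OF finite_adj_blocks finT(3) independence g_bound g_dep dep card_term_blocks_le deg _ mean _ this]
  have s: "0 < L * \<epsilon> / 2" using L_pos \<epsilon>(1) by simp
  show ?meas unfolding event using tail(1) s by simp
  have "prob {\<omega> \<in> space M. val ?D ?D \<omega> \<le> val S S' \<omega>} \<le> exp (- (L * \<epsilon> / 2)\<^sup>2 / (4 * 8 * card T))"
    unfolding event using tail(2) s by simp
  \<comment> \<open>As \<open>card T\<close> is 2 L, one factor L cancels; the bound
    \<open>L_ge\<close> then turns 256 into 512.\<close>
  also have "- (L * \<epsilon> / 2)\<^sup>2 / (4 * 8 * card T) = - (\<epsilon>\<^sup>2 * L / 256)"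
    using L_pos by (simp add: cT power2_eq_square field_simps)
  also have "exp (- (\<epsilon>\<^sup>2 * L / 256)) \<le> exp (- (\<epsilon>\<^sup>2 * (K * (k1 + k2) / 2) / 256))"
    using mult_left_mono[OF L_ge zero_le_power2[of \<epsilon>]] by (simp add: mult_ac)
  also have "\<dots> = exp (- (\<epsilon>\<^sup>2 * K * k / 512))" by (simp add: kk)
  finally show ?tail .
qed

end

section \<open>Weighted count of matchings and the union bound\<close>

lemma sum_power_card_Pow:
  fixes y :: real
  assumes "finite A"
  shows "(\<Sum>U\<in>Pow A. y ^ card U) = (y + 1) ^ card A"
  using prod_add[OF assms, of "\<lambda>_. y" "\<lambda>_. 1"] by simp

text \<open>A matching is determined by the pairs it adds to the diagonal and those it removes,
  equally many of each, so the weight y^2 per added pair is split evenly between the two sets.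
  Letting them range over all subsets of the grid and of the diagonal gives the powers of y +
  1.\<close>

lemma sum_partial_matchings_le:
  fixes y :: real
  assumes y: "0 \<le> y"
  shows "(\<Sum>S\<in>partial_matchings m n K. (y\<^sup>2) ^ card (S - diagonal K)) \<le> (y + 1) ^ (m * n + K)"
proof -
  let ?D = "diagonal K" and ?J = "{..<m} \<times> {..<n}"
  define \<phi> where "\<phi> S = (S - ?D, ?D - S)" for S
  have inj: "inj_on \<phi> (partial_matchings m n K)"
    by (auto simp: inj_on_def \<phi>_def)
  have "(\<Sum>S\<in>partial_matchings m n K. (y\<^sup>2) ^ card (S - ?D)) =
      (\<Sum>S\<in>partial_matchings m n K. (\<lambda>(U, V). y ^ card U * y ^ card V) (\<phi> S))"
  proof (rule sum.cong[OF refl])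
    fix S assume S: "S \<in> partial_matchings m n K"
    have "card (?D - S) = card (S - ?D)"
      using S by (intro card_Diff_eq_card_Diff)
        (auto simp: partial_matchings_def diagonal_def card_image inj_on_def
          intro: finite_partial_matching[OF S])
    then show "(y\<^sup>2) ^ card (S - ?D) = (\<lambda>(U, V). y ^ card U * y ^ card V) (\<phi> S)"
      by (simp add: \<phi>_def power2_eq_square power_mult_distrib)
  qed
  also have "\<dots> = (\<Sum>(U, V)\<in>\<phi> ` partial_matchings m n K. y ^ card U * y ^ card V)"
    by (simp add: sum.reindex[OF inj])
  also have "\<dots> \<le> (\<Sum>(U, V)\<in>Pow ?J \<times> Pow ?D. y ^ card U * y ^ card V)"
    using y by (intro sum_mono2) (auto simp: \<phi>_def partial_matchings_def diagonal_def)
  also have "\<dots> = (\<Sum>U\<in>Pow ?J. y ^ card U) * (\<Sum>V\<in>Pow ?D. y ^ card V)"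
    by (simp add: sum_product sum.cartesian_product)
  also have "\<dots> = (y + 1) ^ (m * n + K)"
    by (simp add: sum_power_card_Pow diagonal_def card_image inj_on_def power_add
        card_cartesian_product)
  finally show ?thesis .
qed

context correlated_bernoulli_graphs
begin

text \<open>6144 = 12 * 512 turns the tail of a pair with k displacements into N^(-12 k). The
  weighted sum over pairs factorises, and each factor is at most exp 2 because (m n + K) N^(-5) is
  at most 2.\<close>

lemma all_matching_pairs_tail:
  fixes q \<epsilon> :: real
  assumes q: "0 < q" "\<And>i j. 1 \<le> i \<Longrightarrow> i < j \<Longrightarrow> j \<le> max m n \<Longrightarrow> p i j \<in> {q..1 - q}"
    and \<rho>_ge: "\<And>i j. 1 \<le> i \<Longrightarrow> i < j \<Longrightarrow> j \<le> K \<Longrightarrow> (1 - 2 * q)\<^sup>2 + \<epsilon> \<le> \<rho> i j"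
    and \<epsilon>: "0 < \<epsilon>" "8 \<le> \<epsilon> * K" "6144 * ln (max m n) \<le> \<epsilon>\<^sup>2 * K" and K2: "2 \<le> K"
  defines "bad \<equiv>
      (\<Union>(S, S')\<in>partial_matchings m n K \<times> partial_matchings m n K - {(diagonal K, diagonal K)}.
       {\<omega> \<in> space M.
          overlap (signed_adj_mat m (G \<omega>)) (signed_adj_mat n (H \<omega>)) (diagonal K) (diagonal K) \<le>
          overlap (signed_adj_mat m (G \<omega>)) (signed_adj_mat n (H \<omega>)) S S'})"
  shows "bad \<in> sets M" (is ?meas)
    and "prob bad \<le> exp 4 / (max m n)\<^sup>2" (is ?tail)
proof -
  let ?P = "partial_matchings m n K" and ?D = "diagonal K"
  define val where
    "val S S' \<omega> = overlap (signed_adj_mat m (G \<omega>)) (signed_adj_mat n (H \<omega>)) S S'" for S S' \<omega>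
  define pairs where "pairs = ?P \<times> ?P - {(?D, ?D)}"
  define E where "E = (\<lambda>(S, S'). {\<omega> \<in> space M. val ?D ?D \<omega> \<le> val S S' \<omega>})"
  define k where "k S = card (S - ?D)" for S :: "(nat \<times> nat) set"
  define N where "N = max m n"
  have N: "2 \<le> N" using K2 K_le by (auto simp: N_def)
  have bad: "bad = (\<Union>t\<in>pairs. E t)" unfolding bad_def pairs_def E_def val_def by simp
  have fin: "finite pairs" unfolding pairs_def using finite_partial_matchings by blast
  have tail: "E (S, S') \<in> sets M" "prob (E (S, S')) \<le> exp (- (\<epsilon>\<^sup>2 * K * (k S + k S') / 512))"
    if "(S, S') \<in> pairs" for S S'
    using matching_pair_tail[OF q \<rho>_ge \<epsilon>(1,2) K2, of S S'] that
    by (auto simp: pairs_def E_def val_def k_def)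
  have meas: "E t \<in> sets M" if "t \<in> pairs" for t
    using tail(1) that by (cases t) auto
  show ?meas unfolding bad using fin meas by blast
  define x where "x = 1 / real N"
  have x: "0 < x" "x \<le> 1" using N by (auto simp: x_def)
  have exp_ln: "exp (- ln (real N)) = x" using N by (simp add: x_def exp_minus field_simps)
  have pair_le: "prob (E (S, S')) \<le> x\<^sup>2 * (((x ^ 5)\<^sup>2) ^ k S * ((x ^ 5)\<^sup>2) ^ k S')"
    if t: "(S, S') \<in> pairs" for S S'
  proof -
    define j where "j = k S + k S'"
    have "j \<noteq> 0"
      using displaced_pair_pos[of S m n K S'] t by (auto simp: pairs_def j_def k_def)
    have "12 * ln (real N) * j \<le> \<epsilon>\<^sup>2 * K / 512 * j"
      using \<epsilon>(3) by (intro mult_right_mono) (auto simp: N_def)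
    then have "prob (E (S, S')) \<le> exp (- (12 * ln (real N) * j))"
      using tail(2)[OF t] by (intro order_trans[OF tail(2)[OF t]]) (simp add: j_def)
    also have "\<dots> = exp (real (12 * j) * (- ln (real N)))" by simp
    also have "\<dots> = x ^ (12 * j)" by (simp only: exp_of_nat_mult exp_ln)
    \<comment> \<open>Uses j \<ge> 1. The exponent 2 is reserved for summability over N; the 10 per
      displaced pair are two shares of 5, one for the added and one for the removed index
      pair.\<close>
    also have "\<dots> \<le> x ^ (2 + 10 * j)"
      using x \<open>j \<noteq> 0\<close> by (intro power_decreasing) auto
    also have "\<dots> = x\<^sup>2 * (((x ^ 5)\<^sup>2) ^ k S * ((x ^ 5)\<^sup>2) ^ k S')"
      by (simp add: j_def power_add power_mult[symmetric] add_mult_distrib2 power2_eq_square[of x])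
    finally show ?thesis .
  qed
  have "prob bad \<le> (\<Sum>t\<in>pairs. prob (E t))"
    unfolding bad using fin meas by (intro finite_measure_subadditive_finite) auto
  also have "\<dots> \<le> (\<Sum>(S, S')\<in>pairs. x\<^sup>2 * (((x ^ 5)\<^sup>2) ^ k S * ((x ^ 5)\<^sup>2) ^ k S'))"
    using pair_le by (intro sum_mono) auto
  \<comment> \<open>Restoring the excluded pair of diagonals makes the index set a product, so that
    the sum factorises.\<close>
  also have "\<dots> \<le> (\<Sum>(S, S')\<in>?P \<times> ?P. x\<^sup>2 * (((x ^ 5)\<^sup>2) ^ k S * ((x ^ 5)\<^sup>2) ^ k S'))"
    using x finite_partial_matchings by (intro sum_mono2) (auto simp: pairs_def)
  also have "\<dots> = x\<^sup>2 * ((\<Sum>S\<in>?P. ((x ^ 5)\<^sup>2) ^ k S) * (\<Sum>S\<in>?P. ((x ^ 5)\<^sup>2) ^ k S))"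
    unfolding sum_product by (simp only: sum.cartesian_product sum_distrib_left case_prod_unfold)
  also have "\<dots> \<le> x\<^sup>2 * (exp 2 * exp 2)"
  proof -
    have "(\<Sum>S\<in>?P. ((x ^ 5)\<^sup>2) ^ k S) \<le> (x ^ 5 + 1) ^ (m * n + K)"
      unfolding k_def using x by (intro sum_partial_matchings_le) auto
    also have "\<dots> \<le> exp (x ^ 5) ^ (m * n + K)"
      using x exp_ge_add_one_self[of "x ^ 5"] by (intro power_mono) (auto simp: add.commute)
    also have "\<dots> = exp (real (m * n + K) * x ^ 5)" by (rule exp_of_nat_mult[symmetric])
    also have "\<dots> \<le> exp 2"
    proof -
      have "m * n \<le> N * N" by (intro mult_le_mono) (simp_all add: N_def)
      moreover have "K \<le> N" using K_le by (simp add: N_def le_max_iff_disj)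
      moreover have "N \<le> N * N" by simp
      ultimately have "m * n + K \<le> N * N + N * N" by linarith
      then have "real (m * n + K) \<le> 2 * real N ^ 2"
        by (simp add: power2_eq_square flip: of_nat_mult of_nat_add)
      then have "real (m * n + K) * x ^ 5 \<le> 2 * real N ^ 2 * x ^ 5"
        using x by (intro mult_right_mono) auto
      also have "\<dots> = 2 * x ^ 3"
        using N by (simp add: x_def field_simps power_numeral_reduce)
      also have "\<dots> \<le> 2" using x by (simp add: power_le_one)
      finally show ?thesis by simp
    qed
    finally have "(\<Sum>S\<in>?P. ((x ^ 5)\<^sup>2) ^ k S) \<le> exp 2" .
    moreover have "0 \<le> (\<Sum>S\<in>?P. ((x ^ 5)\<^sup>2) ^ k S)" using x by (intro sum_nonneg) auto
    ultimately show ?thesis by (intro mult_left_mono mult_mono) auto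
  qed
  also have "\<dots> = exp 4 / (max m n)\<^sup>2"
    by (simp add: x_def N_def power_divide exp_add[symmetric])
  finally show ?tail .
qed

end

section \<open>Borel-Cantelli over all N\<close>

theorem theorem1:
  fixes M :: "'a measure"
    and m n K :: "nat \<Rightarrow> nat"
    and p \<rho> :: "nat \<Rightarrow> nat \<Rightarrow> nat \<Rightarrow> real"
    and q \<epsilon> :: "nat \<Rightarrow> real"
    and G H :: "nat \<Rightarrow> 'a \<Rightarrow> nat pair_pre_digraph"
  assumes "\<And>N. 1 \<le> N \<Longrightarrow> max (m N) (n N) = N"
    and "\<And>N. 1 \<le> N \<Longrightarrow>
           correlated_bernoulli_graphs M (m N) (n N) (K N) (p N) (\<rho> N) (G N) (H N)"
    and "\<And>N. 1 \<le> N \<Longrightarrow> 0 < q N \<and> q N < 1 / 2"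
    and "\<And>N i j. 1 \<le> N \<Longrightarrow> 1 \<le> i \<Longrightarrow> i < j \<Longrightarrow> j \<le> N \<Longrightarrow> p N i j \<in> {q N..1 - q N}"
    and "\<And>N i j. 1 \<le> N \<Longrightarrow> 1 \<le> i \<Longrightarrow> i < j \<Longrightarrow> j \<le> K N \<Longrightarrow> \<rho> N i j > (1 - 2 * q N)\<^sup>2"
    and "\<And>N. 1 \<le> N \<Longrightarrow>
           \<epsilon> N = Min {\<rho> N i j - (1 - 2 * q N)\<^sup>2 | i j. 1 \<le> i \<and> i < j \<and> j \<le> K N}"
    and "filterlim (\<lambda>N. (\<epsilon> N)\<^sup>2 * real (K N) / ln (real N)) at_top sequentially"
  shows "AE \<omega> in M. eventually (\<lambda>N.
           argmax_set
             (\<lambda>X. mat_trace (signed_adj_mat (m N) (G N \<omega>) * X *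
                             signed_adj_mat (n N) (H N \<omega>) * transpose_mat X))
             (partial_perm_mats (m N) (n N) (K N)) =
           argmax_set
             (\<lambda>X. mat_trace (signed_adj_mat (m N) (G N \<omega>) * X *
                             signed_adj_mat (n N) (H N \<omega>) * transpose_mat X))
             (doubly_substochastic_mats (m N) (n N) (K N)) \<and>
           argmax_set
             (\<lambda>X. mat_trace (signed_adj_mat (m N) (G N \<omega>) * X *
                             signed_adj_mat (n N) (H N \<omega>) * transpose_mat X))
             (doubly_substochastic_mats (m N) (n N) (K N)) =
           {core_identity_mat (m N) (n N) (K N)}) sequentially"
proof -
  interpret prob_space M
    using assms(2)[of 1] by (simp add: correlated_bernoulli_graphs_def)
  define val where "val N S S' \<omega> =
      overlap (signed_adj_mat (m N) (G N \<omega>)) (signed_adj_mat (n N) (H N \<omega>)) S S'" for N S S' \<omega>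
  define bad where "bad N = (\<Union>(S, S')\<in>partial_matchings (m N) (n N) (K N) \<times>
        partial_matchings (m N) (n N) (K N) - {(diagonal (K N), diagonal (K N))}.
       {\<omega> \<in> space M. val N (diagonal (K N)) (diagonal (K N)) \<omega> \<le> val N S S' \<omega>})" for N
  define \<epsilon>0 where "\<epsilon>0 = (Min {} :: real)"
  \<comment> \<open>The bound on ln N makes it at least 1 and also larger than
    \<open>\<epsilon>0\<^sup>2\<close>, the value of \<open>\<epsilon>\<^sup>2 * K\<close> when K =
    1.\<close>
  define good where "good N \<longleftrightarrow> 1 \<le> N \<and> 1 + \<epsilon>0\<^sup>2 \<le> ln (real N) \<and>
      6144 \<le> (\<epsilon> N)\<^sup>2 * real (K N) / ln (real N)" for N
  have ev: "eventually good sequentially"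
    unfolding good_def
  proof (intro eventually_conj)
    show "eventually (\<lambda>N. 1 + \<epsilon>0\<^sup>2 \<le> ln (real N)) sequentially"
      using filterlim_compose[OF ln_at_top filterlim_real_sequentially]
      by (simp add: filterlim_at_top)
    show "eventually (\<lambda>N. 6144 \<le> (\<epsilon> N)\<^sup>2 * real (K N) / ln (real N)) sequentially"
      using assms(7) by (simp add: filterlim_at_top)
  qed (rule eventually_ge_at_top)
  have bad: "bad N \<in> sets M" "prob (bad N) \<le> exp 4 / real N ^ 2" if g: "good N" for N
  proof -
    have N: "1 \<le> N" and lnN: "1 + \<epsilon>0\<^sup>2 \<le> ln (real N)"
      and big: "6144 \<le> (\<epsilon> N)\<^sup>2 * real (K N) / ln (real N)" using g by (auto simp: good_def)
    interpret C: correlated_bernoulli_graphs M "m N" "n N" "K N" "p N" "\<rho> N" "G N" "H N"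
      using assms(2)[OF N] .
    have ln1: "1 \<le> ln (real N)" using lnN zero_le_power2[of \<epsilon>0] by linarith
    then have big': "6144 * ln (real N) \<le> (\<epsilon> N)\<^sup>2 * real (K N)"
      using big by (simp add: le_divide_eq)
    define gaps where "gaps = {\<rho> N i j - (1 - 2 * q N)\<^sup>2 | i j. 1 \<le> i \<and> i < j \<and> j \<le> K N}"
    have \<epsilon>: "\<epsilon> N = Min gaps" unfolding gaps_def by (rule assms(6)[OF N])
    \<comment> \<open>If \<open>K = 1\<close> then \<open>\<epsilon>\<close> is the minimum of the empty set, an unspecified constant, which the
      divergence hypothesis excludes for large \<open>N\<close>.\<close>
    have K2: "2 \<le> K N"
    proof (rule ccontr)
      assume "\<not> ?thesis"
      then have K: "K N = 1" using C.K_pos by simp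
      then have "gaps = {}" by (auto simp: gaps_def)
      then have "6144 * ln (real N) \<le> \<epsilon>0\<^sup>2" using big' K by (simp add: \<epsilon> \<epsilon>0_def)
      then show False using lnN ln1 by linarith
    qed
    have fin: "finite gaps"
    proof (rule finite_subset)
      show "gaps \<subseteq> (\<lambda>(i, j). \<rho> N i j - (1 - 2 * q N)\<^sup>2) ` ({..K N} \<times> {..K N})"
      proof
        fix g assume "g \<in> gaps"
        then obtain i j where "g = \<rho> N i j - (1 - 2 * q N)\<^sup>2" "i < j" "j \<le> K N"
          by (auto simp: gaps_def)
        then show "g \<in> (\<lambda>(i, j). \<rho> N i j - (1 - 2 * q N)\<^sup>2) ` ({..K N} \<times> {..K N})"
          by (intro image_eqI[of _ _ "(i, j)"]) auto
      qed
    qed simp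
    have "\<rho> N 1 2 - (1 - 2 * q N)\<^sup>2 \<in> gaps"
      unfolding gaps_def using K2 by (intro CollectI exI[of _ 1] exI[of _ 2]) simp
    then have "gaps \<noteq> {}" by auto
    have \<epsilon>_pos: "0 < \<epsilon> N"
      unfolding \<epsilon> using fin \<open>gaps \<noteq> {}\<close> assms(5)[OF N] by (subst Min_gr_iff) (auto simp: gaps_def)
    have \<rho>_ge: "(1 - 2 * q N)\<^sup>2 + \<epsilon> N \<le> \<rho> N i j" if "1 \<le> i" "i < j" "j \<le> K N" for i j
    proof -
      have "\<epsilon> N \<le> \<rho> N i j - (1 - 2 * q N)\<^sup>2"
        unfolding \<epsilon> using fin that by (intro Min_le) (auto simp: gaps_def)
      then show ?thesis by simp
    qed
    have "(1 - 2 * q N)\<^sup>2 + \<epsilon> N \<le> 1"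
      using \<rho>_ge[of 1 2] C.\<rho>_range[of 1 2] K2 by auto
    then have "\<epsilon> N \<le> 1" using zero_le_power2[of "1 - 2 * q N"] by linarith
    \<comment> \<open>Since \<epsilon> is at most 1, the growth hypothesis on \<epsilon>^2 K also
      bounds \<epsilon> K from below, as required to absorb swaps and loops.\<close>
    then have "(\<epsilon> N)\<^sup>2 * K N \<le> \<epsilon> N * K N"
      using \<epsilon>_pos by (intro mult_right_mono) (auto simp: power2_eq_square mult_left_le)
    then have \<epsilon>K: "8 \<le> \<epsilon> N * K N" using big' ln1 by linarith
    have q: "0 < q N" "\<And>i j. 1 \<le> i \<Longrightarrow> i < j \<Longrightarrow> j \<le> max (m N) (n N) \<Longrightarrow> p N i j \<in> {q N..1 - q N}"
      using assms(3)[OF N] assms(4)[OF N] assms(1)[OF N] by auto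
    have "6144 * ln (max (m N) (n N)) \<le> (\<epsilon> N)\<^sup>2 * K N" using big' assms(1)[OF N] by simp
    from C.all_matching_pairs_tail[OF q \<rho>_ge \<epsilon>_pos \<epsilon>K this K2]
    show "bad N \<in> sets M" "prob (bad N) \<le> exp 4 / real N ^ 2"
      unfolding bad_def val_def assms(1)[OF N] by simp_all
  qed
  \<comment> \<open>Measurability and the tail bound of \<open>bad N\<close> are established only
    for good N; replacing the finitely many others by the empty set does not affect the limit
    statement.\<close>
  define A where "A N = (if good N then bad N else {})" for N
  have "AE \<omega> in M. eventually (\<lambda>N. \<omega> \<in> space M - A N) sequentially"
  proof (rule borel_cantelli_AE1)
    show "A N \<in> sets M" for N by (simp add: A_def bad)
    show "emeasure M (A N) < \<infinity>" for N by (simp add: emeasure_eq_measure)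
    show "summable (\<lambda>N. prob (A N))"
    proof (rule summable_comparison_test')
      show "summable (\<lambda>N. exp 4 * inverse (real N ^ 2))"
        by (intro summable_mult inverse_power_summable) simp
      \<comment> \<open>At N = 0 the right-hand side is 0, because inverse 0 = 0; there
        \<open>A N\<close> is empty, as 0 is not good.\<close>
      show "norm (prob (A N)) \<le> exp 4 * inverse (real N ^ 2)" if "0 \<le> N" for N
        using bad(2)[of N] by (simp add: A_def divide_inverse)
    qed
  qed
  then show ?thesis
  proof (rule AE_mp, intro AE_I2 impI)
    fix \<omega> assume \<omega>: "\<omega> \<in> space M" "eventually (\<lambda>N. \<omega> \<in> space M - A N) sequentially"
    show "eventually (\<lambda>N.
           argmax_set
             (\<lambda>X. mat_trace (signed_adj_mat (m N) (G N \<omega>) * X *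
                             signed_adj_mat (n N) (H N \<omega>) * transpose_mat X))
             (partial_perm_mats (m N) (n N) (K N)) =
           argmax_set
             (\<lambda>X. mat_trace (signed_adj_mat (m N) (G N \<omega>) * X *
                             signed_adj_mat (n N) (H N \<omega>) * transpose_mat X))
             (doubly_substochastic_mats (m N) (n N) (K N)) \<and>
           argmax_set
             (\<lambda>X. mat_trace (signed_adj_mat (m N) (G N \<omega>) * X *
                             signed_adj_mat (n N) (H N \<omega>) * transpose_mat X))
             (doubly_substochastic_mats (m N) (n N) (K N)) =
           {core_identity_mat (m N) (n N) (K N)}) sequentially"
      using \<omega>(2) ev
    proof eventually_elim
      case (elim N)
      then have N: "1 \<le> N" and not_bad: "\<omega> \<notin> bad N" by (auto simp: good_def A_def)
      interpret C: correlated_bernoulli_graphs M "m N" "n N" "K N" "p N" "\<rho> N" "G N" "H N"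
        using assms(2)[OF N] .
      have K: "K N \<le> m N" "K N \<le> n N" using C.K_le by auto
      have carrier: "signed_adj_mat (m N) (G N \<omega>) \<in> carrier_mat (m N) (m N)"
        "signed_adj_mat (n N) (H N \<omega>) \<in> carrier_mat (n N) (n N)"
        by (auto simp: signed_adj_mat_def)
      have less: "overlap (signed_adj_mat (m N) (G N \<omega>)) (signed_adj_mat (n N) (H N \<omega>)) S S' <
          overlap (signed_adj_mat (m N) (G N \<omega>)) (signed_adj_mat (n N) (H N \<omega>))
            (diagonal (K N)) (diagonal (K N))"
        if "S \<in> partial_matchings (m N) (n N) (K N)" "S' \<in> partial_matchings (m N) (n N) (K N)"
          "(S, S') \<noteq> (diagonal (K N), diagonal (K N))" for S S'
      proof -
        have "(S, S') \<in> partial_matchings (m N) (n N) (K N) \<times>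
            partial_matchings (m N) (n N) (K N) - {(diagonal (K N), diagonal (K N))}"
          using that by simp
        then have "\<not> val N (diagonal (K N)) (diagonal (K N)) \<omega> \<le> val N S S' \<omega>"
          using not_bad \<omega>(1) unfolding bad_def by blast
        then show ?thesis by (simp add: val_def)
      qed
      show ?case
        using argmax_trace_eq_core[OF K carrier less] by simp
    qed
  qed
qed

end
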